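(* Let $B$ be a skew left brace and let $G=(B,\star)\rtimes(B,\cdot)$ act on $B$ via $\Theta$. Let $\mathcal{O}$ be the set of orbits, and for each $i\in\mathcal{O}$ fix an element $a_i\in i$, with stabilizer $\operatorname{St}(a_i)\leq G$. Let $I\subseteq\mathcal{O}$ be non-empty with $\bigcup_{i\in I}i$ generating $(B,\star)$, and for each $i\in I$ let $J_i$ be a non-empty set and $\{K_{i,j}\}_{j\in J_i}$ a family of subgroups of $\operatorname{St}(a_i)$ with $\{a\in B:(1,a),(a,a)\in\bigcap_{i\in I}\bigcap_{j\in J_i}\operatorname{core}_G(K_{i,j})\}=\{1\}$. Let $I'\subseteq\mathcal{O}$ be non-empty with $\bigcup_{i'\in I'}i'$ generating $(B,\star)$, and for each $i'\in I'$ let $J'_{i'}$ be a non-empty set and $\{L_{i',j'}\}_{j'\in J'_{i'}}$ a family of subgroups of $\operatorname{St}(a_{i'})$ with $\{a\in B:(1,a),(a,a)\in\bigcap_{i'\in I'}\bigcap_{j'\in J'_{i'}}\operatorname{core}_G(L_{i',j'})\}=\{1\}$. Let $(X,r)$ and $(X',r')$ be the non-degenerate solutions constructed (as described in the context) from the families $\{K_{i,j}\}$ and $\{L_{i',j'}\}$ respectively. Then $(X,r)$ and $(X',r')$ are isomorphic if and only if there exist an automorphism $\psi$ of the skew left brace $B$, a bijective map $\alpha:I\to I'$, for each $i\in I$ a bijective map $\beta_i:J_i\to J'_{\alpha(i)}$, and elements $y_{i,j},z_{i,j}\in B$ for each $i\in I$ and $j\in J_i$, such that $$\psi(a_i)=\Theta_{(y_{i,j},z_{i,j})}(a_{\alpha(i)})\quad\text{and}\quad(\psi\times\psi)(K_{i,j})=(y_{i,j},z_{i,j})\,L_{\alpha(i),\beta_i(j)}\,(y_{i,j},z_{i,j})^{-1}$$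 for all $i\in I$ and $j\in J_i$.
   Context: A skew left brace is a set $B$ with two binary operations $\star,\cdot$ such that $(B,\star)$ and $(B,\cdot)$ are groups and $a\cdot(b\star c)=(a\cdot b)\star a^\star\star(a\cdot c)$ for all $a,b,c\in B$, where $a^\star$ is the inverse of $a$ in $(B,\star)$. The two identity elements coincide and are denoted $1$. Automorphisms of $B$ are bijections preserving both operations. Put $\lambda_a(b)=a^\star\star(a\cdot b)$; then $a\mapsto\lambda_a$ is a group morphism $(B,\cdot)\to\operatorname{Aut}(B,\star)$. The semidirect product $G=(B,\star)\rtimes(B,\cdot)$ has product $(a,b)(a',b')=(a\star\lambda_b(a'),\,b\cdot b')$, and acts on $B$ by automorphisms of $(B,\star)$ via $\Theta_{(a,b)}(c)=a\star\lambda_b(c)\star a^\star$. For $H\leq G$, $\operatorname{core}_G(H)=\bigcap_{g\in G}gHg^{-1}$. The map $\psi\times\psi:G\to G$ is $(a,b)\mapsto(\psi(a),\psi(b))$. A solution (of the Yang-Baxter equation) is a pair $(X,r)$ with $X$ non-empty and $r:X\times X\to X\times X$ bijective with $r_1r_2r_1=r_2r_1r_2$ on $X^3$, where $r_1=r\times\operatorname{id}$, $r_2=\operatorname{id}\times r$. Write $r(x,y)=(f_x(y),g_y(x))$; it is non-degenerate if all $f_x,g_x$ are bijective. Solutions $(X,r)$ and $(Y,s)$ are isomorphic if there is a bijection $F:X\to Y$ with $s(F(x_1),F(x_2))=(F\times F)(r(x_1,x_2))$ for all $x_1,x_2\in X$. Construction: given $I$, $J_i$, $K_{i,j}$ as in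 the claim, put $X=\bigsqcup_{i\in I}\bigsqcup_{j\in J_i}G/K_{i,j}$ (disjoint union of sets of left cosets) and $r(x,y)=(f_x(y),g_y(x))$, where for $x=(b_1,c_1)K_{i_1,j_1}$, $y=(b_2,c_2)K_{i_2,j_2}$, setting $u=\Theta_{(b_1,c_1)}(a_{i_1})$ and $w=\Theta_{(1,u)}\Theta_{(b_2,c_2)}(a_{i_2})$, one has $f_x(y)=(1,u)(b_2,c_2)K_{i_2,j_2}$ and $g_y(x)=(w,w)^{-1}(b_1,c_1)K_{i_1,j_1}$. This is a non-degenerate solution. The solution $(X',r')$ is obtained by the same construction from $I'$, $J'_{i'}$, $L_{i',j'}$, using the same representatives $a_{i'}$. *)

theory Defs
  imports "HOL-Algebra.Group_Action" "HOL-Algebra.Left_Coset" "HOL-Algebra.Generated_Groups"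
begin

section \<open>Skew left braces\<close>

text \<open>Both group structures live on the same carrier; \<open>S\<close> is \<open>(B, \<star>)\<close> and \<open>M\<close> is \<open>(B, \<cdot>)\<close>.\<close>

locale skew_left_brace = star: group S + dot: group M
  for S :: "'b monoid" and M :: "'b monoid" +
  assumes carrier_eq: "carrier M = carrier S"
    and brace_compat: "\<lbrakk>a \<in> carrier S; b \<in> carrier S; c \<in> carrier S\<rbrakk> \<Longrightarrow>
      a \<otimes>\<^bsub>M\<^esub> (b \<otimes>\<^bsub>S\<^esub> c) = (a \<otimes>\<^bsub>M\<^esub> b) \<otimes>\<^bsub>S\<^esub> inv\<^bsub>S\<^esub> a \<otimes>\<^bsub>S\<^esub> (a \<otimes>\<^bsub>M\<^esub> c)"

definition brace_automorphism :: "'b monoid \<Rightarrow> 'b monoid \<Rightarrow> ('b \<Rightarrow> 'b) \<Rightarrow> bool" where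
  "brace_automorphism S M \<psi> \<longleftrightarrow> \<psi> \<in> iso S S \<and> \<psi> \<in> iso M M"

definition brace_lambda :: "'b monoid \<Rightarrow> 'b monoid \<Rightarrow> 'b \<Rightarrow> 'b \<Rightarrow> 'b" where
  "brace_lambda S M a b = inv\<^bsub>S\<^esub> a \<otimes>\<^bsub>S\<^esub> (a \<otimes>\<^bsub>M\<^esub> b)"

definition brace_semidirect :: "'b monoid \<Rightarrow> 'b monoid \<Rightarrow> ('b \<times> 'b) monoid" where
  "brace_semidirect S M =
    \<lparr>carrier = carrier S \<times> carrier M,
     monoid.mult = (\<lambda>(a, b) (a', b'). (a \<otimes>\<^bsub>S\<^esub> brace_lambda S M b a', b \<otimes>\<^bsub>M\<^esub> b')),
     monoid.one = (\<one>\<^bsub>S\<^esub>, \<one>\<^bsub>M\<^esub>)\<rparr>"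

text \<open>The action \<open>\<Theta>\<close>, restricted to the carrier so that it is a
  \<^locale>\<open>group_action\<close> in the sense of the library.\<close>

definition brace_action :: "'b monoid \<Rightarrow> 'b monoid \<Rightarrow> 'b \<times> 'b \<Rightarrow> 'b \<Rightarrow> 'b" where
  "brace_action S M =
    (\<lambda>(a, b). \<lambda>c\<in>carrier S. a \<otimes>\<^bsub>S\<^esub> brace_lambda S M b c \<otimes>\<^bsub>S\<^esub> inv\<^bsub>S\<^esub> a)"

definition normal_core :: "('g, 'm) monoid_scheme \<Rightarrow> 'g set \<Rightarrow> 'g set" where
  "normal_core G H = (\<Inter>g\<in>carrier G. g <#\<^bsub>G\<^esub> H #>\<^bsub>G\<^esub> inv\<^bsub>G\<^esub> g)"

section \<open>Solutions of the Yang--Baxter equation\<close>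

text \<open>Only the values of \<open>r\<close> on \<open>X \<times> X\<close> matter. The components of \<open>r (x, y)\<close> are
  \<open>f\<^sub>x(y) = fst (r (x, y))\<close> and \<open>g\<^sub>y(x) = snd (r (x, y))\<close>.\<close>

definition yb_r1 :: "('x \<times> 'x \<Rightarrow> 'x \<times> 'x) \<Rightarrow> 'x \<times> 'x \<times> 'x \<Rightarrow> 'x \<times> 'x \<times> 'x" where
  "yb_r1 r = (\<lambda>(x, y, z). (fst (r (x, y)), snd (r (x, y)), z))"

definition yb_r2 :: "('x \<times> 'x \<Rightarrow> 'x \<times> 'x) \<Rightarrow> 'x \<times> 'x \<times> 'x \<Rightarrow> 'x \<times> 'x \<times> 'x" where
  "yb_r2 r = (\<lambda>(x, y, z). (x, r (y, z)))"

definition yb_solution :: "'x set \<Rightarrow> ('x \<times> 'x \<Rightarrow> 'x \<times> 'x) \<Rightarrow> bool" where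
  "yb_solution X r \<longleftrightarrow> X \<noteq> {} \<and> bij_betw r (X \<times> X) (X \<times> X) \<and>
    (\<forall>t\<in>X \<times> X \<times> X. yb_r1 r (yb_r2 r (yb_r1 r t)) = yb_r2 r (yb_r1 r (yb_r2 r t)))"

definition yb_nondegenerate :: "'x set \<Rightarrow> ('x \<times> 'x \<Rightarrow> 'x \<times> 'x) \<Rightarrow> bool" where
  "yb_nondegenerate X r \<longleftrightarrow>
    (\<forall>x\<in>X. bij_betw (\<lambda>y. fst (r (x, y))) X X) \<and>
    (\<forall>y\<in>X. bij_betw (\<lambda>x. snd (r (x, y))) X X)"

definition yb_isomorphic ::
  "'x set \<Rightarrow> ('x \<times> 'x \<Rightarrow> 'x \<times> 'x) \<Rightarrow> 'y set \<Rightarrow> ('y \<times> 'y \<Rightarrow> 'y \<times> 'y) \<Rightarrow> bool" where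
  "yb_isomorphic X r Y s \<longleftrightarrow>
    (\<exists>F. bij_betw F X Y \<and>
      (\<forall>x\<^sub>1\<in>X. \<forall>x\<^sub>2\<in>X. s (F x\<^sub>1, F x\<^sub>2) = map_prod F F (r (x\<^sub>1, x\<^sub>2))))"

section \<open>The solution attached to families of subgroups\<close>

text \<open>The disjoint union of the sets \<open>G/K\<^sub>i\<^sub>,\<^sub>j\<close>: its elements are the triples \<open>(i, j, C)\<close> with
  \<open>C\<close> a left coset of \<open>K i j\<close>.\<close>

definition brace_sol_set ::
  "'b monoid \<Rightarrow> 'b monoid \<Rightarrow> 'b set set \<Rightarrow> ('b set \<Rightarrow> 'j set) \<Rightarrow>
    ('b set \<Rightarrow> 'j \<Rightarrow> ('b \<times> 'b) set) \<Rightarrow> ('b set \<times> 'j \<times> ('b \<times> 'b) set) set" where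
  "brace_sol_set S M I J K =
    (SIGMA i:I. SIGMA j:J i. lcosets\<^bsub>brace_semidirect S M\<^esub> (K i j))"

text \<open>The formula for \<open>r\<close> uses a representative of each coset; the result does not depend on the
  choice, see \<open>brace_sol_map_rep\<close> below.\<close>

definition brace_sol_map ::
  "'b monoid \<Rightarrow> 'b monoid \<Rightarrow> ('b set \<Rightarrow> 'b) \<Rightarrow> ('b set \<Rightarrow> 'j \<Rightarrow> ('b \<times> 'b) set) \<Rightarrow>
    ('b set \<times> 'j \<times> ('b \<times> 'b) set) \<times> ('b set \<times> 'j \<times> ('b \<times> 'b) set) \<Rightarrow>
    ('b set \<times> 'j \<times> ('b \<times> 'b) set) \<times> ('b set \<times> 'j \<times> ('b \<times> 'b) set)" where
  "brace_sol_map S M a K = (\<lambda>((i\<^sub>1, j\<^sub>1, C\<^sub>1), (i\<^sub>2, j\<^sub>2, C\<^sub>2)).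
    let G = brace_semidirect S M;
        \<Theta> = brace_action S M;
        h\<^sub>1 = (SOME h. h \<in> C\<^sub>1);
        h\<^sub>2 = (SOME h. h \<in> C\<^sub>2);
        u = \<Theta> h\<^sub>1 (a i\<^sub>1);
        w = \<Theta> (\<one>\<^bsub>S\<^esub>, u) (\<Theta> h\<^sub>2 (a i\<^sub>2))
    in ((i\<^sub>2, j\<^sub>2, ((\<one>\<^bsub>S\<^esub>, u) \<otimes>\<^bsub>G\<^esub> h\<^sub>2) <#\<^bsub>G\<^esub> K i\<^sub>2 j\<^sub>2),
        (i\<^sub>1, j\<^sub>1, (inv\<^bsub>G\<^esub> (w, w) \<otimes>\<^bsub>G\<^esub> h\<^sub>1) <#\<^bsub>G\<^esub> K i\<^sub>1 j\<^sub>1)))"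

section \<open>Well-definedness\<close>

context skew_left_brace
begin

abbreviation G where "G \<equiv> brace_semidirect S M"
abbreviation Th where "Th \<equiv> brace_action S M"
abbreviation lam where "lam \<equiv> brace_lambda S M"
abbreviation st (infixl "\<oslash>" 70) where "a \<oslash> b \<equiv> a \<otimes>\<^bsub>S\<^esub> b"
abbreviation dt (infixl "\<bullet>" 75) where "a \<bullet> b \<equiv> a \<otimes>\<^bsub>M\<^esub> b"
abbreviation B where "B \<equiv> carrier S"

lemma dot_closed [simp, intro]: "a \<in> B \<Longrightarrow> b \<in> B \<Longrightarrow> a \<bullet> b \<in> B"
  using dot.m_closed carrier_eq by simp

lemma dinv_closed [simp, intro]: "a \<in> B \<Longrightarrow> inv\<^bsub>M\<^esub> a \<in> B"
  using dot.inv_closed carrier_eq by simp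

lemma dot_assoc: "a \<in> B \<Longrightarrow> b \<in> B \<Longrightarrow> c \<in> B \<Longrightarrow> a \<bullet> b \<bullet> c = a \<bullet> (b \<bullet> c)"
  using dot.m_assoc carrier_eq by simp

lemma one_M [simp]: "\<one>\<^bsub>M\<^esub> = \<one>\<^bsub>S\<^esub>"
proof -
  have 1: "\<one>\<^bsub>M\<^esub> \<in> B" using dot.one_closed carrier_eq by simp
  have "\<one>\<^bsub>M\<^esub> \<bullet> (\<one>\<^bsub>S\<^esub> \<oslash> \<one>\<^bsub>S\<^esub>) = (\<one>\<^bsub>M\<^esub> \<bullet> \<one>\<^bsub>S\<^esub>) \<oslash> inv\<^bsub>S\<^esub> \<one>\<^bsub>M\<^esub> \<oslash> (\<one>\<^bsub>M\<^esub> \<bullet> \<one>\<^bsub>S\<^esub>)"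
    using brace_compat 1 by blast
  then have "\<one>\<^bsub>S\<^esub> = inv\<^bsub>S\<^esub> \<one>\<^bsub>M\<^esub>"
    using 1 by (simp add: carrier_eq)
  then show ?thesis
    by (metis 1 star.inv_inv star.inv_one)
qed

lemma dot_one [simp]: "a \<in> B \<Longrightarrow> \<one>\<^bsub>S\<^esub> \<bullet> a = a" "a \<in> B \<Longrightarrow> a \<bullet> \<one>\<^bsub>S\<^esub> = a"
  using dot.l_one dot.r_one carrier_eq by auto

lemma dot_inv [simp]: "a \<in> B \<Longrightarrow> inv\<^bsub>M\<^esub> a \<bullet> a = \<one>\<^bsub>S\<^esub>" "a \<in> B \<Longrightarrow> a \<bullet> inv\<^bsub>M\<^esub> a = \<one>\<^bsub>S\<^esub>"
  using dot.l_inv dot.r_inv carrier_eq by auto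

lemma dot_cancel: "a \<in> B \<Longrightarrow> b \<in> B \<Longrightarrow> inv\<^bsub>M\<^esub> a \<bullet> (a \<bullet> b) = b"
  "a \<in> B \<Longrightarrow> b \<in> B \<Longrightarrow> a \<bullet> (inv\<^bsub>M\<^esub> a \<bullet> b) = b"
  by (simp_all add: dot_assoc [symmetric])

lemma star_cancel: "a \<in> B \<Longrightarrow> b \<in> B \<Longrightarrow> inv\<^bsub>S\<^esub> a \<oslash> (a \<oslash> b) = b"
  "a \<in> B \<Longrightarrow> b \<in> B \<Longrightarrow> a \<oslash> (inv\<^bsub>S\<^esub> a \<oslash> b) = b"
  by (simp_all add: star.m_assoc [symmetric])

lemma lam_closed [simp, intro]: "a \<in> B \<Longrightarrow> b \<in> B \<Longrightarrow> lam a b \<in> B"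
  by (simp add: brace_lambda_def)

lemma dot_lam: "a \<in> B \<Longrightarrow> b \<in> B \<Longrightarrow> a \<bullet> b = a \<oslash> lam a b"
  by (simp add: brace_lambda_def star_cancel)

lemma lam_star: "a \<in> B \<Longrightarrow> b \<in> B \<Longrightarrow> c \<in> B \<Longrightarrow> lam a (b \<oslash> c) = lam a b \<oslash> lam a c"
  by (simp add: brace_lambda_def brace_compat star.m_assoc)

lemma lam_one [simp]: "a \<in> B \<Longrightarrow> lam \<one>\<^bsub>S\<^esub> a = a" "a \<in> B \<Longrightarrow> lam a \<one>\<^bsub>S\<^esub> = \<one>\<^bsub>S\<^esub>"
  by (simp_all add: brace_lambda_def)

lemma lam_inv: "a \<in> B \<Longrightarrow> b \<in> B \<Longrightarrow> lam a (inv\<^bsub>S\<^esub> b) = inv\<^bsub>S\<^esub> (lam a b)"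
  by (metis lam_closed lam_one(2) lam_star star.inv_closed star.inv_equality star.l_inv)

lemma lam_dot: "a \<in> B \<Longrightarrow> b \<in> B \<Longrightarrow> c \<in> B \<Longrightarrow> lam (a \<bullet> b) c = lam a (lam b c)"
proof -
  assume *: "a \<in> B" "b \<in> B" "c \<in> B"
  have "(a \<bullet> b) \<oslash> lam a (lam b c) = a \<oslash> lam a (b \<oslash> lam b c)"
    using * by (simp add: dot_lam lam_star star.m_assoc)
  also have "\<dots> = a \<bullet> (b \<bullet> c)" using * by (simp add: dot_lam)
  also have "\<dots> = (a \<bullet> b) \<oslash> lam (a \<bullet> b) c"
    using * by (metis dot_assoc dot_closed dot_lam)
  finally show ?thesis using * by (metis dot_closed lam_closed star_cancel(1))
qed

lemma lam_cancel [simp]: "a \<in> B \<Longrightarrow> b \<in> B \<Longrightarrow> lam (inv\<^bsub>M\<^esub> a) (lam a b) = b"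
  "a \<in> B \<Longrightarrow> b \<in> B \<Longrightarrow> lam a (lam (inv\<^bsub>M\<^esub> a) b) = b"
  by (simp_all add: lam_dot [symmetric])

lemma carrier_G [simp]: "carrier G = B \<times> B"
  by (simp add: brace_semidirect_def carrier_eq)

lemma mult_G [simp]: "(a, b) \<otimes>\<^bsub>G\<^esub> (a', b') = (a \<oslash> lam b a', b \<bullet> b')"
  by (simp add: brace_semidirect_def)

lemma one_G: "\<one>\<^bsub>G\<^esub> = (\<one>\<^bsub>S\<^esub>, \<one>\<^bsub>S\<^esub>)"
  by (simp add: brace_semidirect_def)

sublocale semi: group G
proof (rule groupI)
  fix x y z assume "x \<in> carrier G" "y \<in> carrier G" "z \<in> carrier G"
  then show "x \<otimes>\<^bsub>G\<^esub> y \<otimes>\<^bsub>G\<^esub> z = x \<otimes>\<^bsub>G\<^esub> (y \<otimes>\<^bsub>G\<^esub> z)"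
    by (auto simp: lam_star lam_dot star.m_assoc dot_assoc)
next
  fix x assume "x \<in> carrier G"
  then obtain a b where x: "x = (a, b)" "a \<in> B" "b \<in> B" by auto
  then have "(lam (inv\<^bsub>M\<^esub> b) (inv\<^bsub>S\<^esub> a), inv\<^bsub>M\<^esub> b) \<otimes>\<^bsub>G\<^esub> x = \<one>\<^bsub>G\<^esub>"
    by (simp add: one_G lam_star [symmetric])
  moreover have "(lam (inv\<^bsub>M\<^esub> b) (inv\<^bsub>S\<^esub> a), inv\<^bsub>M\<^esub> b) \<in> carrier G" using x by simp
  ultimately show "\<exists>y\<in>carrier G. y \<otimes>\<^bsub>G\<^esub> x = \<one>\<^bsub>G\<^esub>" by blast
qed (auto simp: one_G)

lemma Th_pair: "c \<in> B \<Longrightarrow> Th (a, b) c = a \<oslash> lam b c \<oslash> inv\<^bsub>S\<^esub> a"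
  by (simp add: brace_action_def)

lemma Th_closed [simp, intro]: "g \<in> carrier G \<Longrightarrow> c \<in> B \<Longrightarrow> Th g c \<in> B"
  by (auto simp: Th_pair)

lemma Th_mult: "\<lbrakk>g \<in> carrier G; h \<in> carrier G; c \<in> B\<rbrakk> \<Longrightarrow> Th (g \<otimes>\<^bsub>G\<^esub> h) c = Th g (Th h c)"
  by (auto simp: Th_pair lam_star lam_dot lam_inv star.m_assoc star.inv_mult_group)

lemma Th_one [simp]: "c \<in> B \<Longrightarrow> Th \<one>\<^bsub>G\<^esub> c = c"
  by (simp add: one_G Th_pair)

lemma Th_inv [simp]: "g \<in> carrier G \<Longrightarrow> c \<in> B \<Longrightarrow> Th g (Th (inv\<^bsub>G\<^esub> g) c) = c"
  "g \<in> carrier G \<Longrightarrow> c \<in> B \<Longrightarrow> Th (inv\<^bsub>G\<^esub> g) (Th g c) = c"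
  by (metis Th_mult Th_one semi.inv_closed semi.r_inv)
     (metis Th_mult Th_one semi.inv_closed semi.l_inv)

lemma Th_Bij: "g \<in> carrier G \<Longrightarrow> Th g \<in> Bij B"
proof -
  assume g: "g \<in> carrier G"
  have "Th g \<in> extensional B" by (cases g) (simp add: brace_action_def)
  moreover have "bij_betw (Th g) B B"
    by (rule bij_betw_byWitness [where f' = "Th (inv\<^bsub>G\<^esub> g)"])
       (use g Th_closed semi.inv_closed in auto)
  ultimately show ?thesis by (simp add: Bij_def)
qed

lemma brace_group_action: "group_action G B Th"
  unfolding group_action_def
proof (rule group_hom.intro)
  show "group G" "group (BijGroup B)" by (simp_all add: semi.is_group group_BijGroup)
  have "Th (g \<otimes>\<^bsub>G\<^esub> h) = compose B (Th g) (Th h)" if "g \<in> carrier G" "h \<in> carrier G" for g h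
  proof (rule extensionalityI [where A = B])
    show "Th (g \<otimes>\<^bsub>G\<^esub> h) \<in> extensional B" "compose B (Th g) (Th h) \<in> extensional B"
      using Th_Bij semi.m_closed that by (auto simp: Bij_def compose_def)
  qed (use that Th_mult in \<open>simp add: compose_def\<close>)
  then show "group_hom_axioms G (BijGroup B) Th"
    using Th_Bij by unfold_locales (auto simp: hom_def BijGroup_def simp del: carrier_G)
qed

lemma brace_dot_Th: "u \<in> B \<Longrightarrow> w \<in> B \<Longrightarrow> Th (w, w) u \<oslash> w = w \<bullet> u"
  by (simp add: Th_pair dot_lam star.m_assoc)

lemma dot_inv_lam:
  assumes "u \<in> B" "v \<in> B"
  shows "inv\<^bsub>M\<^esub> u \<bullet> lam u v = inv\<^bsub>M\<^esub> u \<oslash> v"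
proof -
  have "inv\<^bsub>M\<^esub> u \<oslash> lam (inv\<^bsub>M\<^esub> u) (lam u v) = inv\<^bsub>M\<^esub> u \<oslash> v"
    using assms by simp
  then show ?thesis using assms by (simp add: dot_lam)
qed

lemma diag_mult: "b \<in> B \<Longrightarrow> c \<in> B \<Longrightarrow> (b, b) \<otimes>\<^bsub>G\<^esub> (c, c) = (b \<bullet> c, b \<bullet> c)"
  by (simp add: dot_lam)

context
  fixes I :: "'b set set" and J :: "'b set \<Rightarrow> 'j set"
    and K :: "'b set \<Rightarrow> 'j \<Rightarrow> ('b \<times> 'b) set" and a :: "'b set \<Rightarrow> 'b"
  assumes a_mem: "\<And>i. i \<in> I \<Longrightarrow> a i \<in> B"
    and K_sub: "\<And>i j. i \<in> I \<Longrightarrow> j \<in> J i \<Longrightarrow> subgroup (K i j) G"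
    and K_stab: "\<And>i j. i \<in> I \<Longrightarrow> j \<in> J i \<Longrightarrow> K i j \<subseteq> stabilizer G Th (a i)"
begin

private abbreviation X where "X \<equiv> brace_sol_set S M I J K"
private abbreviation r where "r \<equiv> brace_sol_map S M a K"
private definition act where "act g = (\<lambda>(i, j, C). (i, j, g <#\<^bsub>G\<^esub> C))"
private definition lab where "lab = (\<lambda>(i, j, C). Th (SOME h. h \<in> C) (a i))"

private lemma coset_rep:
  assumes "i \<in> I" "j \<in> J i" "h \<in> carrier G" "h' \<in> h <#\<^bsub>G\<^esub> K i j"
  shows "h' \<in> carrier G" "Th h' (a i) = Th h (a i)" "h' <#\<^bsub>G\<^esub> K i j = h <#\<^bsub>G\<^esub> K i j"
proof -
  interpret K: subgroup "K i j" G using K_sub assms by blast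
  obtain k where k: "k \<in> K i j" "h' = h \<otimes>\<^bsub>G\<^esub> k"
    using assms(4) by (auto simp: l_coset_def simp del: carrier_G mult_G)
  have kG: "k \<in> carrier G" using k K.mem_carrier by blast
  show "h' \<in> carrier G" using k kG assms semi.m_closed by blast
  have "Th k (a i) = a i" using K_stab [OF assms(1,2)] k by (auto simp: stabilizer_def)
  then show "Th h' (a i) = Th h (a i)" using k kG assms a_mem Th_mult by simp
  show "h' <#\<^bsub>G\<^esub> K i j = h <#\<^bsub>G\<^esub> K i j"
    using semi.l_repr_independence [OF assms(4,3) K.subgroup_axioms] by simp
qed

private lemma rep_some:
  assumes "i \<in> I" "j \<in> J i" "h \<in> carrier G"
  shows "(SOME h'. h' \<in> h <#\<^bsub>G\<^esub> K i j) \<in> h <#\<^bsub>G\<^esub> K i j"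
proof -
  have "h \<otimes>\<^bsub>G\<^esub> \<one>\<^bsub>G\<^esub> \<in> h <#\<^bsub>G\<^esub> K i j"
    using subgroup.one_closed [OF K_sub] assms unfolding l_coset_def by blast
  then show ?thesis by (metis someI)
qed

private lemma X_cases:
  assumes "x \<in> X"
  obtains i j h where "x = (i, j, h <#\<^bsub>G\<^esub> K i j)" "i \<in> I" "j \<in> J i" "h \<in> carrier G"
  using assms unfolding brace_sol_set_def LCOSETS_def by blast

private lemma X_I: "i \<in> I \<Longrightarrow> j \<in> J i \<Longrightarrow> h \<in> carrier G \<Longrightarrow> (i, j, h <#\<^bsub>G\<^esub> K i j) \<in> X"
  unfolding brace_sol_set_def LCOSETS_def by blast

private lemma lab_rep:
  "i \<in> I \<Longrightarrow> j \<in> J i \<Longrightarrow> h \<in> carrier G \<Longrightarrow> lab (i, j, h <#\<^bsub>G\<^esub> K i j) = Th h (a i)"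
  unfolding lab_def using coset_rep(2) rep_some by simp

private lemma act_rep:
  "i \<in> I \<Longrightarrow> j \<in> J i \<Longrightarrow> h \<in> carrier G \<Longrightarrow> g \<in> carrier G \<Longrightarrow>
    act g (i, j, h <#\<^bsub>G\<^esub> K i j) = (i, j, (g \<otimes>\<^bsub>G\<^esub> h) <#\<^bsub>G\<^esub> K i j)"
  unfolding act_def using semi.lcos_m_assoc [OF subgroup.subset [OF K_sub]] by simp

private lemma lab_closed: "x \<in> X \<Longrightarrow> lab x \<in> B"
  by (erule X_cases) (metis lab_rep Th_closed a_mem)

private lemma act_closed: "x \<in> X \<Longrightarrow> g \<in> carrier G \<Longrightarrow> act g x \<in> X"
  by (erule X_cases) (metis act_rep X_I semi.m_closed)

private lemma act_mult:
  "x \<in> X \<Longrightarrow> g \<in> carrier G \<Longrightarrow> h \<in> carrier G \<Longrightarrow> act g (act h x) = act (g \<otimes>\<^bsub>G\<^esub> h) x"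
  by (erule X_cases) (metis act_rep semi.m_closed semi.m_assoc)

private lemma act_one: "x \<in> X \<Longrightarrow> act \<one>\<^bsub>G\<^esub> x = x"
  by (erule X_cases) (metis act_rep semi.one_closed semi.l_one)

private lemma lab_act: "x \<in> X \<Longrightarrow> g \<in> carrier G \<Longrightarrow> lab (act g x) = Th g (lab x)"
  by (erule X_cases) (metis act_rep lab_rep semi.m_closed Th_mult a_mem)

theorem brace_sol_map_rep:
  assumes "i\<^sub>1 \<in> I" "j\<^sub>1 \<in> J i\<^sub>1" "h\<^sub>1 \<in> carrier G"
    and "i\<^sub>2 \<in> I" "j\<^sub>2 \<in> J i\<^sub>2" "h\<^sub>2 \<in> carrier G"
  defines "u \<equiv> Th h\<^sub>1 (a i\<^sub>1)"
  defines "w \<equiv> Th (\<one>\<^bsub>S\<^esub>, u) (Th h\<^sub>2 (a i\<^sub>2))"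
  shows "brace_sol_map S M a K ((i\<^sub>1, j\<^sub>1, h\<^sub>1 <#\<^bsub>G\<^esub> K i\<^sub>1 j\<^sub>1), (i\<^sub>2, j\<^sub>2, h\<^sub>2 <#\<^bsub>G\<^esub> K i\<^sub>2 j\<^sub>2)) =
    ((i\<^sub>2, j\<^sub>2, ((\<one>\<^bsub>S\<^esub>, u) \<otimes>\<^bsub>G\<^esub> h\<^sub>2) <#\<^bsub>G\<^esub> K i\<^sub>2 j\<^sub>2),
     (i\<^sub>1, j\<^sub>1, (inv\<^bsub>G\<^esub> (w, w) \<otimes>\<^bsub>G\<^esub> h\<^sub>1) <#\<^bsub>G\<^esub> K i\<^sub>1 j\<^sub>1))"
proof -
  define k\<^sub>1 where "k\<^sub>1 = (SOME h. h \<in> h\<^sub>1 <#\<^bsub>G\<^esub> K i\<^sub>1 j\<^sub>1)"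
  define k\<^sub>2 where "k\<^sub>2 = (SOME h. h \<in> h\<^sub>2 <#\<^bsub>G\<^esub> K i\<^sub>2 j\<^sub>2)"
  have k1: "k\<^sub>1 \<in> carrier G" "Th k\<^sub>1 (a i\<^sub>1) = Th h\<^sub>1 (a i\<^sub>1)"
      "k\<^sub>1 <#\<^bsub>G\<^esub> K i\<^sub>1 j\<^sub>1 = h\<^sub>1 <#\<^bsub>G\<^esub> K i\<^sub>1 j\<^sub>1"
    and k2: "k\<^sub>2 \<in> carrier G" "Th k\<^sub>2 (a i\<^sub>2) = Th h\<^sub>2 (a i\<^sub>2)"
      "k\<^sub>2 <#\<^bsub>G\<^esub> K i\<^sub>2 j\<^sub>2 = h\<^sub>2 <#\<^bsub>G\<^esub> K i\<^sub>2 j\<^sub>2"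
    using coset_rep [OF assms(1-3) rep_some [OF assms(1-3)]]
      coset_rep [OF assms(4-6) rep_some [OF assms(4-6)]]
    unfolding k\<^sub>1_def k\<^sub>2_def by simp_all
  have u: "u \<in> B" unfolding u_def using assms(1,3) a_mem Th_closed by blast
  have w: "w \<in> B" unfolding w_def using assms(4,6) a_mem Th_closed u by auto
  have g: "(\<one>\<^bsub>S\<^esub>, u) \<in> carrier G" "inv\<^bsub>G\<^esub> (w, w) \<in> carrier G"
    using u w semi.inv_closed [of "(w, w)"] by simp_all
  have *: "(g \<otimes>\<^bsub>G\<^esub> k) <#\<^bsub>G\<^esub> K i j = (g \<otimes>\<^bsub>G\<^esub> h) <#\<^bsub>G\<^esub> K i j"
    if "g \<in> carrier G" "k \<in> carrier G" "h \<in> carrier G" "k <#\<^bsub>G\<^esub> K i j = h <#\<^bsub>G\<^esub> K i j"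
      "i \<in> I" "j \<in> J i" for g k h i j
    using that act_rep [of i j k g] act_rep [of i j h g] by simp
  show ?thesis
    unfolding brace_sol_map_def Let_def prod.case
      k\<^sub>1_def [symmetric] k\<^sub>2_def [symmetric] k1(2) k2(2) u_def [symmetric] w_def [symmetric]
      * [OF g(1) k2(1) assms(6) k2(3) assms(4,5)] * [OF g(2) k1(1) assms(3) k1(3) assms(1,2)]
    by (rule refl)
qed

private lemma r_eq:
  assumes "x \<in> X" "y \<in> X"
  shows "r (x, y) = (act (\<one>\<^bsub>S\<^esub>, lab x) y,
    act (inv\<^bsub>G\<^esub> (lam (lab x) (lab y), lam (lab x) (lab y))) x)"
proof -
  obtain i1 j1 h1 where x: "x = (i1, j1, h1 <#\<^bsub>G\<^esub> K i1 j1)" "i1 \<in> I" "j1 \<in> J i1" "h1 \<in> carrier G"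
    using assms X_cases by metis
  obtain i2 j2 h2 where y: "y = (i2, j2, h2 <#\<^bsub>G\<^esub> K i2 j2)" "i2 \<in> I" "j2 \<in> J i2" "h2 \<in> carrier G"
    using assms X_cases by metis
  have l: "lab x = Th h1 (a i1)" "lab y = Th h2 (a i2)" using x y lab_rep by simp_all
  have lc: "lab x \<in> B" "lab y \<in> B" using assms lab_closed by simp_all
  have w: "Th (\<one>\<^bsub>S\<^esub>, lab x) (lab y) = lam (lab x) (lab y)"
    using lc by (simp add: Th_pair)
  have g: "(\<one>\<^bsub>S\<^esub>, lab x) \<in> carrier G"
    "inv\<^bsub>G\<^esub> (lam (lab x) (lab y), lam (lab x) (lab y)) \<in> carrier G"
    using lc semi.inv_closed [of "(lam (lab x) (lab y), lam (lab x) (lab y))"] by simp_all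
  show ?thesis
    using brace_sol_map_rep [OF x(2-4) y(2-4), folded l x(1) y(1), unfolded w,
        folded act_rep [OF y(2-4) g(1)] act_rep [OF x(2-4) g(2)] x(1) y(1)] .
qed

private abbreviation dg where "dg b \<equiv> (b, b)"

private lemma dgc: "b \<in> B \<Longrightarrow> dg b \<in> carrier G" "b \<in> B \<Longrightarrow> (\<one>\<^bsub>S\<^esub>, b) \<in> carrier G"
  "b \<in> B \<Longrightarrow> inv\<^bsub>G\<^esub> (dg b) \<in> carrier G" "b \<in> B \<Longrightarrow> inv\<^bsub>G\<^esub> (\<one>\<^bsub>S\<^esub>, b) \<in> carrier G"
  by (rule semi.inv_closed | simp)+

private lemma act_inv:
  assumes "x \<in> X" "g \<in> carrier G"
  shows "act g (act (inv\<^bsub>G\<^esub> g) x) = x" "act (inv\<^bsub>G\<^esub> g) (act g x) = x"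
  using assms act_mult [of x g "inv\<^bsub>G\<^esub> g"] act_mult [of x "inv\<^bsub>G\<^esub> g" g] act_one
  by (simp_all only: semi.inv_closed semi.r_inv semi.l_inv)

private lemma lab_f: "x \<in> X \<Longrightarrow> y \<in> X \<Longrightarrow> lab (act (\<one>\<^bsub>S\<^esub>, lab x) y) = lam (lab x) (lab y)"
  using lab_closed by (simp add: lab_act Th_pair)

text \<open>The labels satisfy \<open>f\<^sub>x(y) \<cdot> g\<^sub>y(x) = x \<cdot> y\<close>.\<close>

private lemma Th_inv_lam:
  assumes "u \<in> B" "v \<in> B"
  shows "lam u v \<bullet> Th (inv\<^bsub>G\<^esub> (dg (lam u v))) u = u \<bullet> v"
proof -
  let ?t = "Th (inv\<^bsub>G\<^esub> (dg (lam u v))) u"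
  have t: "?t \<in> B" using assms dgc by simp
  have 1: "Th (dg (lam u v)) ?t = u" using assms dgc by (simp del: carrier_G)
  have "lam u v \<bullet> ?t = Th (dg (lam u v)) ?t \<oslash> lam u v"
    using assms t by (simp only: brace_dot_Th lam_closed)
  then show ?thesis using assms dot_lam [of u v] 1 by simp
qed

private lemma lab_g:
  assumes "x \<in> X" "y \<in> X"
  shows "lab (act (inv\<^bsub>G\<^esub> (dg (lam (lab x) (lab y)))) x) =
    inv\<^bsub>M\<^esub> (lam (lab x) (lab y)) \<bullet> (lab x \<bullet> lab y)"
proof -
  have l: "lab x \<in> B" "lab y \<in> B" using assms lab_closed by auto
  let ?t = "Th (inv\<^bsub>G\<^esub> (dg (lam (lab x) (lab y)))) (lab x)"
  have "?t = inv\<^bsub>M\<^esub> (lam (lab x) (lab y)) \<bullet> (lam (lab x) (lab y) \<bullet> ?t)"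
    using l dgc by (simp add: dot_cancel)
  then show ?thesis using l assms dgc lab_act Th_inv_lam by simp
qed

private lemma f_X: "x \<in> X \<Longrightarrow> y \<in> X \<Longrightarrow> act (\<one>\<^bsub>S\<^esub>, lab x) y \<in> X"
  by (intro act_closed dgc lab_closed)

private lemma g_X: "x \<in> X \<Longrightarrow> y \<in> X \<Longrightarrow> act (inv\<^bsub>G\<^esub> (dg (lam (lab x) (lab y)))) x \<in> X"
  by (intro act_closed dgc lab_closed lam_closed)

private lemma inv_dg_mult:
  assumes "b \<in> B" "c \<in> B"
  shows "inv\<^bsub>G\<^esub> (dg b) \<otimes>\<^bsub>G\<^esub> inv\<^bsub>G\<^esub> (dg c) = inv\<^bsub>G\<^esub> (dg (c \<bullet> b))"
  using assms semi.inv_mult_group [of "dg c" "dg b"] dgc(1) diag_mult by simp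

private lemma braid:
  assumes x: "x \<in> X" and y: "y \<in> X" and z: "z \<in> X"
  shows "yb_r1 r (yb_r2 r (yb_r1 r (x, y, z))) = yb_r2 r (yb_r1 r (yb_r2 r (x, y, z)))"
proof -
  define u v t where "u = lab x" and "v = lab y" and "t = lab z"
  have B: "u \<in> B" "v \<in> B" "t \<in> B" using lab_closed assms by (auto simp: u_def v_def t_def)
  let ?s = "inv\<^bsub>M\<^esub> (lam u v) \<bullet> (u \<bullet> v)"
  have s: "?s \<in> B" using B by simp
  define y1 x1 where "y1 = act (\<one>\<^bsub>S\<^esub>, u) y" and "x1 = act (inv\<^bsub>G\<^esub> (dg (lam u v))) x"
  have X1: "y1 \<in> X" "x1 \<in> X" using f_X g_X assms by (auto simp: y1_def x1_def u_def v_def)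
  have L1: "lab y1 = lam u v" "lab x1 = ?s"
    using lab_f lab_g assms by (auto simp: y1_def x1_def u_def v_def)
  have r1: "r (x, y) = (y1, x1)" using r_eq x y by (simp add: y1_def x1_def u_def v_def)
  define z2 x2 where "z2 = act (\<one>\<^bsub>S\<^esub>, ?s) z" and "x2 = act (inv\<^bsub>G\<^esub> (dg (lam ?s t))) x1"
  have X2: "z2 \<in> X" "x2 \<in> X" using f_X [OF X1(2) z] g_X [OF X1(2) z] L1
    by (simp_all add: z2_def x2_def t_def)
  have L2: "lab z2 = lam ?s t" using lab_f [OF X1(2) z] L1 by (simp add: z2_def t_def)
  have r2: "r (x1, z) = (z2, x2)" using r_eq [OF X1(2) z] L1 by (simp add: z2_def x2_def t_def)
  have W1: "lam (lam u v) (lam ?s t) = lam (u \<bullet> v) t"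
    using B s by (simp add: lam_dot [symmetric] dot_cancel)
  have r3: "r (y1, z2) = (act (\<one>\<^bsub>S\<^esub>, lam u v) z2, act (inv\<^bsub>G\<^esub> (dg (lam (u \<bullet> v) t))) y1)"
    using r_eq [OF X1(1) X2(1)] L1 L2 W1 by simp
  define z3 y3 where "z3 = act (\<one>\<^bsub>S\<^esub>, v) z" and "y3 = act (inv\<^bsub>G\<^esub> (dg (lam v t))) y"
  have X3: "z3 \<in> X" "y3 \<in> X" using f_X g_X assms by (auto simp: z3_def y3_def t_def v_def)
  have L3: "lab z3 = lam v t" "lab y3 = inv\<^bsub>M\<^esub> (lam v t) \<bullet> (v \<bullet> t)"
    using lab_f lab_g assms by (auto simp: z3_def y3_def t_def v_def)
  have r4: "r (y, z) = (z3, y3)" using r_eq y z by (simp add: z3_def y3_def t_def v_def)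
  have W2: "lam u (lam v t) = lam (u \<bullet> v) t" using B by (simp add: lam_dot)
  define x4 where "x4 = act (inv\<^bsub>G\<^esub> (dg (lam (u \<bullet> v) t))) x"
  have X4: "x4 \<in> X" using g_X [OF x X3(1)] L3 W2 by (simp add: x4_def u_def)
  have L4: "lab x4 = inv\<^bsub>M\<^esub> (lam (u \<bullet> v) t) \<bullet> (u \<bullet> lam v t)"
    using lab_g [OF x X3(1)] L3 W2 by (simp add: x4_def u_def)
  have r5: "r (x, z3) = (act (\<one>\<^bsub>S\<^esub>, u) z3, x4)"
    using r_eq [OF x X3(1)] L3 W2 by (simp add: x4_def u_def)
  let ?s' = "inv\<^bsub>M\<^esub> (lam (u \<bullet> v) t) \<bullet> (u \<bullet> lam v t)"
  have s': "?s' \<in> B" using B by simp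
  let ?q = "inv\<^bsub>M\<^esub> (lam v t) \<bullet> (v \<bullet> t)"
  let ?w = "lam ?s' ?q"
  have q: "?q \<in> B" using B by simp
  have W3: "lam u v \<bullet> lam ?s t = lam (u \<bullet> v) t \<bullet> ?w"
  proof -
    have "lam u v \<bullet> lam ?s t = lam u v \<oslash> lam (u \<bullet> v) t"
      using B s W1 by (simp add: dot_lam)
    also have "\<dots> = lam u (v \<oslash> lam v t)" using B by (simp add: lam_dot lam_star)
    also have "v \<oslash> lam v t = lam v t \<oslash> lam (lam v t) ?q"
      using B q by (metis dot_cancel(2) dot_closed dot_lam lam_closed)
    also have "lam u \<dots> = lam (u \<bullet> v) t \<oslash> lam (u \<bullet> lam v t) ?q"
      using B q by (simp add: lam_star lam_dot)
    also have "lam (u \<bullet> lam v t) ?q = lam (lam (u \<bullet> v) t \<bullet> ?s') ?q"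
      using B by (simp add: dot_cancel)
    also have "\<dots> = lam (lam (u \<bullet> v) t) ?w"
      by (rule lam_dot) (use B s' q in auto)
    finally show ?thesis using B s' q by (simp add: dot_lam)
  qed
  have r6: "r (x4, y3) = (act (\<one>\<^bsub>S\<^esub>, ?s') y3, act (inv\<^bsub>G\<^esub> (dg ?w)) x4)"
    using r_eq [OF X4 X3(2)] L3 L4 by simp
  have E1: "act (\<one>\<^bsub>S\<^esub>, lam u v) z2 = act (\<one>\<^bsub>S\<^esub>, u) z3"
  proof -
    have "act (\<one>\<^bsub>S\<^esub>, lam u v) z2 = act (\<one>\<^bsub>S\<^esub>, u \<bullet> v) z"
      unfolding z2_def using act_mult [OF z dgc(2) dgc(2), of "lam u v" ?s] B s
      by (simp add: dot_cancel)
    also have "\<dots> = act (\<one>\<^bsub>S\<^esub>, u) z3"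
      unfolding z3_def using act_mult [OF z dgc(2) dgc(2), of u v] B by simp
    finally show ?thesis .
  qed
  have E2: "act (inv\<^bsub>G\<^esub> (dg (lam (u \<bullet> v) t))) y1 = act (\<one>\<^bsub>S\<^esub>, ?s') y3"
  proof -
    let ?p = "lam v t" and ?w1 = "lam (u \<bullet> v) t"
    have p: "?p \<in> B" "?w1 \<in> B" using B by auto
    have y3': "y = act (dg ?p) y3"
      unfolding y3_def using act_inv(1) [OF y dgc(1) [OF p(1)]] by simp
    have e: "(\<one>\<^bsub>S\<^esub>, u) \<otimes>\<^bsub>G\<^esub> dg ?p = dg ?w1 \<otimes>\<^bsub>G\<^esub> (\<one>\<^bsub>S\<^esub>, ?s')"
      using B p by (simp add: W2 dot_cancel)
    have "y1 = act (\<one>\<^bsub>S\<^esub>, u) (act (dg ?p) y3)" unfolding y1_def using y3' by simp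
    also have "\<dots> = act (dg ?w1 \<otimes>\<^bsub>G\<^esub> (\<one>\<^bsub>S\<^esub>, ?s')) y3"
      using act_mult [OF X3(2) dgc(2) [OF B(1)] dgc(1) [OF p(1)]] e by simp
    also have "\<dots> = act (dg ?w1) (act (\<one>\<^bsub>S\<^esub>, ?s') y3)"
      using act_mult [OF X3(2) dgc(1) [OF p(2)] dgc(2) [OF s']] by simp
    finally show ?thesis
      using act_inv(2) [OF act_closed [OF X3(2) dgc(2) [OF s']] dgc(1) [OF p(2)]] by simp
  qed
  have E3: "x2 = act (inv\<^bsub>G\<^esub> (dg ?w)) x4"
  proof -
    have c: "lam ?s t \<in> B" "lam u v \<in> B" "?w \<in> B" "lam (u \<bullet> v) t \<in> B" using B s s' q by auto
    have "x2 = act (inv\<^bsub>G\<^esub> (dg (lam u v \<bullet> lam ?s t))) x"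
      unfolding x2_def x1_def
      using act_mult [OF x dgc(3) [OF c(1)] dgc(3) [OF c(2)]] inv_dg_mult [OF c(1,2)] by simp
    also have "\<dots> = act (inv\<^bsub>G\<^esub> (dg ?w)) x4"
      unfolding x4_def W3
      using act_mult [OF x dgc(3) [OF c(3)] dgc(3) [OF c(4)]] inv_dg_mult [OF c(3,4)] by simp
    finally show ?thesis .
  qed
  show ?thesis
    unfolding yb_r1_def yb_r2_def by (simp add: r1 r2 r3 r4 r5 r6 E1 E2 E3)
qed

private lemma r_bij: "bij_betw r (X \<times> X) (X \<times> X)"
proof -
  define s :: "('b set \<times> 'j \<times> ('b \<times> 'b) set) \<times> ('b set \<times> 'j \<times> ('b \<times> 'b) set) \<Rightarrow> _" where
    "s = (\<lambda>(p, q). let x = act (dg (lab p)) q in (x, act (inv\<^bsub>G\<^esub> (\<one>\<^bsub>S\<^esub>, lab x)) p))"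
  show ?thesis
  proof (rule bij_betw_byWitness [where f' = s])
    show "\<forall>t\<in>X \<times> X. s (r t) = t"
    proof clarify
      fix x1 x2 x3 y1 y2 y3 assume *: "(x1, x2, x3) \<in> X" "(y1, y2, y3) \<in> X"
      define x y where "x = (x1, x2, x3)" and "y = (y1, y2, y3)"
      have xy: "x \<in> X" "y \<in> X" using * by (auto simp: x_def y_def)
      have l: "lab x \<in> B" "lab y \<in> B" "lam (lab x) (lab y) \<in> B" using xy lab_closed by auto
      have "s (r (x, y)) = (x, y)"
        unfolding s_def using xy l r_eq lab_f act_inv(1) [OF xy(1) dgc(1)]
          act_inv(2) [OF xy(2) dgc(2)] by (simp add: Let_def)
      then show "s (r ((x1, x2, x3), (y1, y2, y3))) = ((x1, x2, x3), (y1, y2, y3))"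
        by (simp add: x_def y_def)
    qed
    have sX: "s (p, q) \<in> X \<times> X" if "p \<in> X" "q \<in> X" for p q
      unfolding s_def Let_def using that act_closed dgc lab_closed by simp
    then show "s ` (X \<times> X) \<subseteq> X \<times> X" by blast
    show "r ` (X \<times> X) \<subseteq> X \<times> X"
    proof (rule image_subsetI)
      fix t assume "t \<in> X \<times> X"
      then obtain x y where "t = (x, y)" "x \<in> X" "y \<in> X" by blast
      then show "r t \<in> X \<times> X" using r_eq f_X g_X by simp
    qed
    show "\<forall>t\<in>X \<times> X. r (s t) = t"
    proof
      fix t assume "t \<in> X \<times> X"
      then obtain p q where t: "t = (p, q)" and pq: "p \<in> X" "q \<in> X" by blast
      define x y where "x = act (dg (lab p)) q" and "y = act (inv\<^bsub>G\<^esub> (\<one>\<^bsub>S\<^esub>, lab x)) p"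
      have l: "lab p \<in> B" using pq lab_closed by simp
      have x: "x \<in> X" unfolding x_def by (intro act_closed dgc l pq)
      have lx: "lab x \<in> B" using x lab_closed by simp
      have y: "y \<in> X" unfolding y_def by (intro act_closed dgc lx pq)
      have fy: "act (\<one>\<^bsub>S\<^esub>, lab x) y = p"
        unfolding y_def using act_inv(1) [OF pq(1) dgc(2) [OF lx]] .
      then have w: "lam (lab x) (lab y) = lab p" using lab_f [OF x y] by simp
      have "r (x, y) = (p, q)"
        using r_eq [OF x y] fy w act_inv(2) [OF pq(2) dgc(1) [OF l]] by (simp add: x_def)
      moreover have "s t = (x, y)" by (simp add: s_def t x_def y_def Let_def)
      ultimately show "r (s t) = t" using t by simp
    qed
  qed
qed

private lemma f_bij: "x \<in> X \<Longrightarrow> bij_betw (\<lambda>y. fst (r (x, y))) X X"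
proof -
  assume x: "x \<in> X"
  then have l: "lab x \<in> B" using lab_closed by simp
  show ?thesis
    by (rule bij_betw_byWitness [where f' = "act (inv\<^bsub>G\<^esub> (\<one>\<^bsub>S\<^esub>, lab x))"])
       (use x r_eq [OF x] f_X [OF x] act_inv [OF _ dgc(2) [OF l]] act_closed [OF _ dgc(4) [OF l]]
         in \<open>simp_all add: image_subset_iff\<close>)
qed

private lemma g_bij:
  assumes y: "y \<in> X"
  shows "bij_betw (\<lambda>x. snd (r (x, y))) X X"
proof -
  define v where "v = lab y"
  have v: "v \<in> B" using y lab_closed by (simp add: v_def)
  define e where "e t = inv\<^bsub>M\<^esub> (v \<bullet> inv\<^bsub>M\<^esub> t \<oslash> inv\<^bsub>S\<^esub> v)" for t
  have e: "e t \<in> B" if "t \<in> B" for t using that v by (simp add: e_def)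
  have minv: "inv\<^bsub>M\<^esub> (inv\<^bsub>M\<^esub> u) = u" "inv\<^bsub>M\<^esub> (u \<bullet> w) = inv\<^bsub>M\<^esub> w \<bullet> inv\<^bsub>M\<^esub> u"
    if "u \<in> B" "w \<in> B" for u w
    using that dot.inv_inv dot.inv_mult_group by (simp_all add: carrier_eq)
  have e1: "e (inv\<^bsub>M\<^esub> (lam u v) \<bullet> (u \<bullet> v)) = u" if u: "u \<in> B" for u
  proof -
    have "v \<bullet> inv\<^bsub>M\<^esub> (inv\<^bsub>M\<^esub> (lam u v) \<bullet> (u \<bullet> v)) = inv\<^bsub>M\<^esub> u \<bullet> lam u v"
      using u v by (simp add: minv dot_assoc dot_cancel)
    then have "v \<bullet> inv\<^bsub>M\<^esub> (inv\<^bsub>M\<^esub> (lam u v) \<bullet> (u \<bullet> v)) \<oslash> inv\<^bsub>S\<^esub> v = inv\<^bsub>M\<^esub> u"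
      using u v by (simp add: dot_inv_lam star.m_assoc)
    then show ?thesis using u by (simp add: e_def minv)
  qed
  have e2: "inv\<^bsub>M\<^esub> (lam (e t) v) \<bullet> (e t \<bullet> v) = t" if t: "t \<in> B" for t
  proof -
    have "inv\<^bsub>M\<^esub> (e t) \<bullet> lam (e t) v = inv\<^bsub>M\<^esub> (e t) \<oslash> v"
      using e t v by (simp add: dot_inv_lam)
    also have "\<dots> = v \<bullet> inv\<^bsub>M\<^esub> t"
      using t v by (simp add: e_def minv star.m_assoc)
    finally have "lam (e t) v = e t \<bullet> (v \<bullet> inv\<^bsub>M\<^esub> t)"
      using e t v by (metis dot_cancel(2) lam_closed)
    then show ?thesis using e t v by (simp add: minv dot_assoc dot_cancel)
  qed
  define k :: "('b set \<times> 'j \<times> ('b \<times> 'b) set) \<Rightarrow> _" where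
    "k q = act (dg (lam (e (lab q)) v)) q" for q
  show ?thesis
  proof (rule bij_betw_byWitness [where f' = k])
    show "\<forall>x\<in>X. k (snd (r (x, y))) = x"
    proof
      fix x assume x: "x \<in> X"
      have u: "lab x \<in> B" using x lab_closed by simp
      have "k (act (inv\<^bsub>G\<^esub> (dg (lam (lab x) v))) x) = x"
        using lab_g [OF x y, folded v_def] e1 [OF u]
          act_inv(1) [OF x dgc(1) [OF lam_closed [OF u v]]] by (simp add: k_def)
      then show "k (snd (r (x, y))) = x" using r_eq [OF x y] by (simp add: v_def)
    qed
    show "(\<lambda>x. snd (r (x, y))) ` X \<subseteq> X"
      using r_eq [OF _ y] g_X [OF _ y] by (simp add: image_subset_iff)
    have kX: "k q \<in> X" if "q \<in> X" for q
      unfolding k_def by (intro act_closed dgc(1) e lab_closed v lam_closed that)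
    then show "k ` X \<subseteq> X" by blast
    show "\<forall>q\<in>X. snd (r (k q, y)) = q"
    proof
      fix q assume q: "q \<in> X"
      have t: "lab q \<in> B" using q lab_closed by simp
      let ?u = "e (lab q)" and ?w = "lam (e (lab q)) v"
      have w: "?u \<in> B" "?w \<in> B" using e t v by auto
      have "Th (dg ?w) (lab q) \<oslash> ?w = ?w \<bullet> lab q" using w t by (simp add: brace_dot_Th)
      also have "\<dots> = ?w \<bullet> (inv\<^bsub>M\<^esub> ?w \<bullet> (?u \<bullet> v))" using e2 [OF t] by simp
      also have "\<dots> = ?u \<oslash> ?w" using w v by (simp add: dot_cancel dot_lam [of ?u v])
      finally have "Th (dg ?w) (lab q) = ?u"
        using w t star.right_cancel [of ?w "Th (dg ?w) (lab q)" ?u] by simp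
      then have "lab (k q) = ?u" using lab_act [OF q dgc(1) [OF w(2)]] by (simp add: k_def)
      then show "snd (r (k q, y)) = q"
        using r_eq [OF kX [OF q] y] act_inv(2) [OF q dgc(1) [OF w(2)]]
        by (simp add: v_def [symmetric] k_def)
    qed
  qed
qed

theorem brace_sol_nondegenerate_solution:
  assumes "I \<noteq> {}" "\<And>i. i \<in> I \<Longrightarrow> J i \<noteq> {}"
  shows "yb_solution X r" "yb_nondegenerate X r"
proof -
  obtain i j where "i \<in> I" "j \<in> J i" using assms by blast
  then have "X \<noteq> {}" using X_I semi.one_closed by blast
  then show "yb_solution X r" unfolding yb_solution_def using r_bij braid by auto
  show "yb_nondegenerate X r" unfolding yb_nondegenerate_def using f_bij g_bij by blast
qed

end

end

end

theory Submission
  imports Defs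
begin

text \<open>
  Everything visible to the solution on \<open>X\<close> is the action of \<open>G\<close> on the disjoint union of the
  cosets together with the equivariant label \<open>lab (h K\<^sub>i\<^sub>,\<^sub>j) = \<Theta>\<^sub>h(a\<^sub>i)\<close>: with \<open>w = \<lambda>\<^bsub>lab x\<^esub>(lab y)\<close>,
  \<open>r (x, y) = ((1, lab x) y, (w, w)\<^sup>-\<^sup>1 x)\<close>. So an isomorphism \<open>F\<close> of solutions satisfies
  \<open>F ((1, b) x) = (1, b') F x\<close> and \<open>F ((b, b) x) = (b', b') F x\<close> whenever \<open>b = lab z\<close> and
  \<open>b' = lab (F z)\<close>. The set of pairs \<open>(b, b')\<close> with this property is a subgroup of
  \<open>(B, \<cdot>) \<times> (B, \<cdot>)\<close>. It projects onto both factors because the labels, being stable under all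
  \<open>\<lambda>\<^sub>b\<close> and generating \<open>(B, \<star>)\<close>, also generate \<open>(B, \<cdot>)\<close>
  (\<open>lambda_invariant_generates_dot\<close>); and both projections are injective by the condition on the
  cores. Hence it is the graph of a \<open>\<cdot>\<close>-automorphism \<open>\<psi>\<close>. The equivariance of the labels makes
  \<open>\<psi>\<close> commute with \<open>\<lambda>\<close> on labels, which gives compatibility with \<open>\<star>\<close>, first for a label as
  right factor and then for all of \<open>B\<close>. As the elements \<open>(1, b)\<close> and \<open>(b, b)\<close> generate \<open>G\<close>, \<open>F\<close> is
  equivariant along \<open>\<psi> \<times> \<psi>\<close> (\<open>solution_isomorphism_induces_automorphism\<close>). The
  converse, \<open>equivariant_map_solution_isomorphism\<close>, is immediate from the formula for \<open>r\<close>.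

  It remains to describe the bijections of coset spaces that are equivariant along an automorphism
  of \<open>G\<close> and respect labels. Such a bijection maps \<open>G\<close>-orbits, that is components
  \<open>G/K\<^sub>i\<^sub>,\<^sub>j\<close>, onto components, and this gives \<open>\<alpha>\<close> and \<open>\<beta>\<close>; the first index \<open>\<alpha>(i)\<close> is the orbit
  \<open>\<psi> ` i\<close>, independently of \<open>j\<close>, since each label determines its orbit. If the base point of
  \<open>G/K\<^sub>i\<^sub>,\<^sub>j\<close> goes to the coset of \<open>(y, z)\<close>, comparison of labels gives the equation for \<open>\<psi>(a\<^sub>i)\<close>,
  and comparison of stabilizers gives the one for \<open>K\<^sub>i\<^sub>,\<^sub>j\<close>. Conversely, such data define the
  bijection \<open>h K\<^sub>i\<^sub>,\<^sub>j \<mapsto> (\<psi> \<times> \<psi>)(h) (y, z) L\<close>.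
\<close>

section \<open>Left cosets and conjugate subgroups\<close>

lemma (in group) lcos_eq_iff:
  assumes "subgroup H G" "x \<in> carrier G" "y \<in> carrier G"
  shows "x <# H = y <# H \<longleftrightarrow> inv x \<otimes> y \<in> H"
proof -
  have "x <# H = y <# H \<longleftrightarrow> y \<in> x <# H"
    using assms l_repr_independence lcos_self by blast
  also have "\<dots> \<longleftrightarrow> inv x \<otimes> y \<in> H"
    using assms subgroup.lcos_module_imp subgroup.lcos_module_rev is_group by metis
  finally show ?thesis .
qed

lemma (in group) mem_conjugate_iff:
  assumes "H \<subseteq> carrier G" "g \<in> carrier G" "k \<in> carrier G"
  shows "k \<in> g <# H #> inv g \<longleftrightarrow> inv g \<otimes> k \<otimes> g \<in> H"
proof
  assume "k \<in> g <# H #> inv g"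
  then obtain h where "h \<in> H" "k = g \<otimes> h \<otimes> inv g"
    unfolding l_coset_def r_coset_def by blast
  then show "inv g \<otimes> k \<otimes> g \<in> H"
    using assms by (simp add: m_assoc subset_iff) (simp add: m_assoc [symmetric] subset_iff)
next
  assume "inv g \<otimes> k \<otimes> g \<in> H"
  moreover have "k = g \<otimes> (inv g \<otimes> k \<otimes> g) \<otimes> inv g"
    using assms by (simp add: m_assoc) (simp add: m_assoc [symmetric])
  ultimately show "k \<in> g <# H #> inv g"
    unfolding l_coset_def r_coset_def by blast
qed

lemma (in group) lcos_stabilizer:
  assumes H: "subgroup H G" and "g \<in> carrier G" "k \<in> carrier G"
  shows "(k \<otimes> g) <# H = g <# H \<longleftrightarrow> k \<in> g <# H #> inv g"
  using lcos_eq_iff [OF H, of g "k \<otimes> g"] mem_conjugate_iff [OF subgroup.subset [OF H], of g k]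
    assms m_assoc by auto

lemma (in group) mult_inv_cancel:
  "\<lbrakk>x \<in> carrier G; y \<in> carrier G\<rbrakk> \<Longrightarrow> x \<otimes> inv y \<otimes> y = x"
  by (simp add: m_assoc)

lemma (in group) rcoset_inv_cancel:
  "\<lbrakk>C \<subseteq> carrier G; y \<in> carrier G\<rbrakk> \<Longrightarrow> C #> y #> inv y = C"
  by (simp add: coset_mult_assoc)

lemma (in group) conjugate_lcos:
  assumes "H \<subseteq> carrier G" "g \<in> carrier G" "h \<in> carrier G"
  shows "h <# (g <# H #> inv g) #> g = (h \<otimes> g) <# H"
proof -
  have gH: "g <# H \<subseteq> carrier G" using assms by (simp add: l_coset_subset_G)
  have "h <# (g <# H #> inv g) #> g = h <# ((g <# H #> inv g) #> g)"
    using assms gH by (simp add: coset_assoc r_coset_subset_G)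
  also have "(g <# H #> inv g) #> g = g <# H"
    using assms gH by (simp add: coset_mult_assoc)
  finally show ?thesis using assms by (simp add: lcos_m_assoc)
qed

lemma (in group_hom) image_lcos:
  assumes "g \<in> carrier G" "K \<subseteq> carrier G"
  shows "h ` (g <#\<^bsub>G\<^esub> K) = h g <#\<^bsub>H\<^esub> h ` K"
  using assms hom_mult by (force simp: l_coset_def subset_iff image_iff)

section \<open>Generation and automorphisms of skew left braces\<close>

context skew_left_brace
begin

text \<open>The two products differ by a twist by \<open>\<lambda>\<close>, which preserves \<open>\<Lambda>\<close>: for \<open>x\<close> in \<open>\<Lambda>\<close> the element
  \<open>h \<star> x\<close> equals \<open>h \<cdot> y\<close> for some other \<open>y\<close> in \<open>\<Lambda>\<close>. So a \<open>\<cdot>\<close>-subgroup containing \<open>\<Lambda>\<close>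
  is stable under right \<open>\<star>\<close>-multiplication by \<open>\<Lambda>\<close> and its inverses.\<close>

lemma lambda_invariant_generates_dot:
  assumes gen: "generate S \<Lambda> = B" and \<Lambda>: "\<Lambda> \<subseteq> B"
    and invariant: "\<And>b x. b \<in> B \<Longrightarrow> x \<in> \<Lambda> \<Longrightarrow> lam b x \<in> \<Lambda>"
    and H: "subgroup H M" and "\<Lambda> \<subseteq> H"
  shows "H = B"
proof -
  interpret H: subgroup H M by (rule H)
  have HB: "H \<subseteq> B" using H.subset carrier_eq by simp
  have "\<forall>h\<in>H. h \<oslash> b \<in> H" if "b \<in> generate S \<Lambda>" for b
    using that
  proof (induction rule: generate.induct)
    case one
    then show ?case using HB by auto
  next
    case (incl x)
    show ?case
    proof
      fix h assume h: "h \<in> H"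
      have "h \<oslash> x = h \<bullet> lam (inv\<^bsub>M\<^esub> h) x"
        using h HB \<Lambda> incl by (simp add: dot_lam subset_iff)
      also have "\<dots> \<in> H" using h HB incl invariant \<open>\<Lambda> \<subseteq> H\<close> by (meson H.m_closed dinv_closed subsetD)
      finally show "h \<oslash> x \<in> H" .
    qed
  next
    case (inv x)
    show ?case
    proof
      fix h assume h: "h \<in> H"
      \<comment> \<open>With \<open>k = h \<star> x\<^sup>\<star>\<close> one has \<open>h = k \<star> x = k \<cdot> y\<close> for a \<open>y\<close> in \<open>\<Lambda>\<close>, so \<open>k\<close> is
        the product of \<open>h\<close> and the \<open>\<cdot>\<close>-inverse of \<open>y\<close>.\<close>
      define k where "k = h \<oslash> inv\<^bsub>S\<^esub> x"
      define y where "y = lam (inv\<^bsub>M\<^esub> k) x"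
      have B: "h \<in> B" "x \<in> B" "k \<in> B" using h HB \<Lambda> inv by (auto simp: k_def)
      have y: "y \<in> \<Lambda>" "y \<in> B" using invariant inv B \<Lambda> by (auto simp: y_def)
      have "h = k \<oslash> x" using B by (simp add: k_def star.m_assoc)
      also have "\<dots> = k \<bullet> y" using B by (simp add: y_def dot_lam)
      finally have "h \<bullet> inv\<^bsub>M\<^esub> y = k" using B y by (simp add: dot_assoc)
      then show "h \<oslash> inv\<^bsub>S\<^esub> x \<in> H" using h y \<open>\<Lambda> \<subseteq> H\<close> k_def by (metis H.m_closed H.m_inv_closed subsetD)
    qed
  next
    case (eng b c)
    show ?case
    proof
      fix h assume "h \<in> H"
      then have "h \<oslash> b \<oslash> c \<in> H" "h \<in> B" using eng.IH HB by blast+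
      then show "h \<oslash> (b \<oslash> c) \<in> H"
        using eng.hyps gen star.m_assoc [of h b c] by simp
    qed
  qed
  then have "\<one>\<^bsub>S\<^esub> \<oslash> b \<in> H" if "b \<in> B" for b
    using that gen H.one_closed one_M by metis
  then show ?thesis using HB by auto
qed

lemma inv_dot_part: "b \<in> B \<Longrightarrow> inv\<^bsub>G\<^esub> (\<one>\<^bsub>S\<^esub>, b) = (\<one>\<^bsub>S\<^esub>, inv\<^bsub>M\<^esub> b)"
  by (rule semi.inv_equality) (simp_all add: one_G)

lemma inv_diag: "b \<in> B \<Longrightarrow> inv\<^bsub>G\<^esub> (b, b) = (inv\<^bsub>M\<^esub> b, inv\<^bsub>M\<^esub> b)"
  by (rule semi.inv_equality) (simp_all add: one_G diag_mult del: mult_G)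

lemma dot_part_mult: "b \<in> B \<Longrightarrow> c \<in> B \<Longrightarrow> (\<one>\<^bsub>S\<^esub>, b) \<otimes>\<^bsub>G\<^esub> (\<one>\<^bsub>S\<^esub>, c) = (\<one>\<^bsub>S\<^esub>, b \<bullet> c)"
  by simp

lemma diag_dot_part_factor:
  "b \<in> B \<Longrightarrow> c \<in> B \<Longrightarrow> (b, c) = (b, b) \<otimes>\<^bsub>G\<^esub> (\<one>\<^bsub>S\<^esub>, inv\<^bsub>M\<^esub> b \<bullet> c)"
  by (simp add: dot_cancel)

lemma brace_automorphism_lam:
  assumes "brace_automorphism S M \<psi>" "b \<in> B" "c \<in> B"
  shows "\<psi> (lam b c) = lam (\<psi> b) (\<psi> c)"
proof -
  have h: "\<psi> \<in> hom S S" "\<psi> \<in> hom M M"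
    using assms by (auto simp: brace_automorphism_def iso_def)
  interpret h: group_hom S S \<psi>
    using h by (simp add: group_hom_def group_hom_axioms_def star.is_group)
  show ?thesis
    using assms(2,3) hom_mult [OF h(2)] by (simp add: brace_lambda_def carrier_eq)
qed

lemma brace_automorphism_semidirect:
  assumes "brace_automorphism S M \<psi>"
  shows "map_prod \<psi> \<psi> \<in> iso G G"
proof -
  have h: "\<psi> \<in> hom S S" "\<psi> \<in> hom M M" and b: "bij_betw \<psi> B B"
    using assms by (auto simp: brace_automorphism_def iso_def)
  have c: "\<psi> b \<in> B" if "b \<in> B" for b using b that by (auto simp: bij_betw_def)
  have "map_prod \<psi> \<psi> \<in> hom G G"
    using hom_mult [OF h(1)] hom_mult [OF h(2)] c brace_automorphism_lam [OF assms]
    by (intro homI) (auto simp: carrier_eq)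
  moreover have "bij_betw (map_prod \<psi> \<psi>) (carrier G) (carrier G)"
    using bij_betw_map_prod [OF b b] by simp
  ultimately show ?thesis by (simp add: iso_def)
qed

lemma brace_automorphism_Th:
  assumes "brace_automorphism S M \<psi>" "g \<in> carrier G" "c \<in> B"
  shows "\<psi> (Th g c) = Th (map_prod \<psi> \<psi> g) (\<psi> c)"
proof -
  obtain b d where g: "g = (b, d)" "b \<in> B" "d \<in> B" using assms(2) by auto
  have h: "\<psi> \<in> hom S S"
    using assms by (auto simp: brace_automorphism_def iso_def)
  interpret h: group_hom S S \<psi>
    using h by (simp add: group_hom_def group_hom_axioms_def star.is_group)
  show ?thesis
    using g assms brace_automorphism_lam [OF assms(1)] by (simp add: Th_pair)
qed

end

text \<open>The features of the coset construction that determine the solution: a \<open>G\<close>-set with an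
  equivariant map to \<open>B\<close>. The last axiom is the abstract form of the condition on cores, because
  the intersection of the cores is the kernel of the action.\<close>

section \<open>Solutions from labelled actions\<close>

locale labelled_action = skew_left_brace S M
  for S M :: "'b monoid" +
  fixes X :: "'x set" and act :: "'b \<times> 'b \<Rightarrow> 'x \<Rightarrow> 'x" and lab :: "'x \<Rightarrow> 'b"
  assumes act_closed: "\<lbrakk>g \<in> carrier (brace_semidirect S M); x \<in> X\<rbrakk> \<Longrightarrow> act g x \<in> X"
    and act_mult: "\<lbrakk>g \<in> carrier (brace_semidirect S M); h \<in> carrier (brace_semidirect S M); x \<in> X\<rbrakk> \<Longrightarrow>
      act (g \<otimes>\<^bsub>brace_semidirect S M\<^esub> h) x = act g (act h x)"
    and act_one: "x \<in> X \<Longrightarrow> act \<one>\<^bsub>brace_semidirect S M\<^esub> x = x"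
    and lab_closed: "x \<in> X \<Longrightarrow> lab x \<in> carrier S"
    and lab_act: "\<lbrakk>g \<in> carrier (brace_semidirect S M); x \<in> X\<rbrakk> \<Longrightarrow>
      lab (act g x) = brace_action S M g (lab x)"
    and lab_generate: "generate S (lab ` X) = carrier S"
    and faithful: "\<lbrakk>b \<in> carrier S; \<And>x. x \<in> X \<Longrightarrow> act (\<one>\<^bsub>S\<^esub>, b) x = x;
      \<And>x. x \<in> X \<Longrightarrow> act (b, b) x = x\<rbrakk> \<Longrightarrow> b = \<one>\<^bsub>S\<^esub>"
begin

definition sol :: "'x \<times> 'x \<Rightarrow> 'x \<times> 'x" where
  "sol = (\<lambda>(x, y). (act (\<one>\<^bsub>S\<^esub>, lab x) y,
    act (inv\<^bsub>G\<^esub> (lam (lab x) (lab y), lam (lab x) (lab y))) x))"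

lemma act_inv:
  assumes "g \<in> carrier G" "x \<in> X"
  shows "act g (act (inv\<^bsub>G\<^esub> g) x) = x" "act (inv\<^bsub>G\<^esub> g) (act g x) = x"
  using assms act_mult [of g "inv\<^bsub>G\<^esub> g" x] act_mult [of "inv\<^bsub>G\<^esub> g" g x] act_one
  by (simp_all only: semi.inv_closed semi.r_inv semi.l_inv)

lemma act_eq_iff:
  assumes "g \<in> carrier G" "h \<in> carrier G" "x \<in> X"
  shows "act g x = act h x \<longleftrightarrow> act (inv\<^bsub>G\<^esub> h \<otimes>\<^bsub>G\<^esub> g) x = x"
  using assms act_inv [of h] act_mult act_closed semi.inv_closed by metis

lemma lab_act_dot_part:
  "b \<in> B \<Longrightarrow> x \<in> X \<Longrightarrow> lab (act (\<one>\<^bsub>S\<^esub>, b) x) = lam b (lab x)"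
  by (simp add: lab_act lab_closed Th_pair)

lemma faithful_eq:
  assumes "b \<in> B" "c \<in> B"
    and "\<And>x. x \<in> X \<Longrightarrow> act (\<one>\<^bsub>S\<^esub>, b) x = act (\<one>\<^bsub>S\<^esub>, c) x"
    and "\<And>x. x \<in> X \<Longrightarrow> act (b, b) x = act (c, c) x"
  shows "b = c"
proof -
  have "inv\<^bsub>M\<^esub> c \<bullet> b = \<one>\<^bsub>S\<^esub>"
  proof (rule faithful)
    show "inv\<^bsub>M\<^esub> c \<bullet> b \<in> B" using assms by simp
    fix x assume x: "x \<in> X"
    show "act (\<one>\<^bsub>S\<^esub>, inv\<^bsub>M\<^esub> c \<bullet> b) x = x"
      using act_eq_iff [of "(\<one>\<^bsub>S\<^esub>, b)" "(\<one>\<^bsub>S\<^esub>, c)" x] assms x by (simp add: inv_dot_part)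
    have "act (inv\<^bsub>G\<^esub> (c, c) \<otimes>\<^bsub>G\<^esub> (b, b)) x = x"
      using act_eq_iff [of "(b, b)" "(c, c)" x] assms x by simp
    then show "act (inv\<^bsub>M\<^esub> c \<bullet> b, inv\<^bsub>M\<^esub> c \<bullet> b) x = x"
      using assms by (simp add: inv_diag diag_mult del: mult_G)
  qed
  then show ?thesis using assms dot_cancel(2) [of c b] by simp
qed

lemma subgroup_containing_labels:
  assumes "subgroup H M" "lab ` X \<subseteq> H"
  shows "H = B"
proof (rule lambda_invariant_generates_dot [OF lab_generate _ _ assms])
  show "lab ` X \<subseteq> B" using lab_closed by blast
  fix b l assume "b \<in> B" "l \<in> lab ` X"
  then show "lam b l \<in> lab ` X"
    using lab_act_dot_part act_closed
    by (auto simp flip: lab_act_dot_part)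
qed

end

section \<open>Isomorphisms of solutions as equivariant bijections\<close>

locale labelled_action_pair = skew_left_brace S M +
  dom: labelled_action S M X act lab + cod: labelled_action S M Y act' lab'
  for S M :: "'b monoid"
    and X :: "'x set" and act :: "'b \<times> 'b \<Rightarrow> 'x \<Rightarrow> 'x" and lab :: "'x \<Rightarrow> 'b"
    and Y :: "'y set" and act' :: "'b \<times> 'b \<Rightarrow> 'y \<Rightarrow> 'y" and lab' :: "'y \<Rightarrow> 'b" +
  fixes F :: "'x \<Rightarrow> 'y"
  assumes F_bij: "bij_betw F X Y"
begin

definition transports :: "'b \<times> 'b \<Rightarrow> 'b \<times> 'b \<Rightarrow> bool" where
  "transports g g' \<longleftrightarrow> g \<in> carrier G \<and> g' \<in> carrier G \<and> (\<forall>x\<in>X. F (act g x) = act' g' (F x))"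

text \<open>Both copies \<open>b \<mapsto> (1, b)\<close> and \<open>b \<mapsto> (b, b)\<close> of \<open>(B, \<cdot>)\<close> in \<open>G\<close> occur because the first
  acts in the left component of the solution and the second in the right one. Together they
  generate \<open>G\<close> and determine \<open>b\<close>, so this relation is the graph of the
  automorphism that is sought.\<close>

definition transports_brace :: "'b \<Rightarrow> 'b \<Rightarrow> bool" where
  "transports_brace b b' \<longleftrightarrow> transports (\<one>\<^bsub>S\<^esub>, b) (\<one>\<^bsub>S\<^esub>, b') \<and> transports (b, b) (b', b')"

lemma F_closed: "x \<in> X \<Longrightarrow> F x \<in> Y"
  using F_bij by (auto simp: bij_betw_def)

lemma F_eq_iff: "x \<in> X \<Longrightarrow> y \<in> X \<Longrightarrow> F x = F y \<longleftrightarrow> x = y"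
  using F_bij by (auto simp: bij_betw_def inj_on_def)

lemma F_surj: "y \<in> Y \<Longrightarrow> \<exists>x\<in>X. y = F x"
  using F_bij by (auto simp: bij_betw_def)

lemma transports_mult:
  assumes "transports g g'" "transports h h'"
  shows "transports (g \<otimes>\<^bsub>G\<^esub> h) (g' \<otimes>\<^bsub>G\<^esub> h')"
  using assms unfolding transports_def
  by (simp add: dom.act_mult cod.act_mult dom.act_closed F_closed del: carrier_G mult_G)

lemma transports_inv:
  assumes "transports g g'"
  shows "transports (inv\<^bsub>G\<^esub> g) (inv\<^bsub>G\<^esub> g')"
  unfolding transports_def
proof (intro conjI ballI)
  show "inv\<^bsub>G\<^esub> g \<in> carrier G" "inv\<^bsub>G\<^esub> g' \<in> carrier G"
    using assms semi.inv_closed unfolding transports_def by blast+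
  fix x assume x: "x \<in> X"
  have g: "g \<in> carrier G" "g' \<in> carrier G" and y: "act (inv\<^bsub>G\<^esub> g) x \<in> X"
    using assms x dom.act_closed semi.inv_closed unfolding transports_def by blast+
  have "F x = act' g' (F (act (inv\<^bsub>G\<^esub> g) x))"
    using assms y dom.act_inv(1) [OF g(1) x] unfolding transports_def by metis
  then show "F (act (inv\<^bsub>G\<^esub> g) x) = act' (inv\<^bsub>G\<^esub> g') (F x)"
    using cod.act_inv(2) [OF g(2) F_closed [OF y]] by simp
qed

lemma transports_brace_closed: "transports_brace b b' \<Longrightarrow> b \<in> B \<and> b' \<in> B"
  by (simp add: transports_brace_def transports_def)

lemma transports_brace_mult:
  assumes "transports_brace b b'" "transports_brace c c'"
  shows "transports_brace (b \<bullet> c) (b' \<bullet> c')"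
  using assms transports_brace_closed [OF assms(1)] transports_brace_closed [OF assms(2)]
    transports_mult [of "(\<one>\<^bsub>S\<^esub>, b)" "(\<one>\<^bsub>S\<^esub>, b')" "(\<one>\<^bsub>S\<^esub>, c)" "(\<one>\<^bsub>S\<^esub>, c')"]
    transports_mult [of "(b, b)" "(b', b')" "(c, c)" "(c', c')"]
  unfolding transports_brace_def by (simp add: diag_mult dot_part_mult del: mult_G)

lemma transports_brace_inv:
  assumes "transports_brace b b'"
  shows "transports_brace (inv\<^bsub>M\<^esub> b) (inv\<^bsub>M\<^esub> b')"
  using assms transports_brace_closed [OF assms]
    transports_inv [of "(\<one>\<^bsub>S\<^esub>, b)" "(\<one>\<^bsub>S\<^esub>, b')"] transports_inv [of "(b, b)" "(b', b')"]
  unfolding transports_brace_def by (simp add: inv_diag inv_dot_part)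

lemma transports_brace_one: "transports_brace \<one>\<^bsub>S\<^esub> \<one>\<^bsub>S\<^esub>"
  using dom.act_one cod.act_one F_closed
  unfolding transports_brace_def transports_def one_G by simp

text \<open>Faithfulness on \<open>Y\<close> makes the relation single-valued, faithfulness on \<open>X\<close> makes it injective.\<close>

lemma transports_brace_unique:
  assumes "transports_brace b b'" "transports_brace c c'"
  shows "b = c \<longleftrightarrow> b' = c'"
proof
  have B: "b \<in> B" "b' \<in> B" "c \<in> B" "c' \<in> B" using assms transports_brace_closed by blast+
  note t = assms [unfolded transports_brace_def transports_def]
  show "b' = c'" if "b = c"
  proof (rule cod.faithful_eq [OF B(2,4)])
    fix y assume "y \<in> Y"
    then obtain x where "x \<in> X" "y = F x" using F_surj by blast
    then show "act' (\<one>\<^bsub>S\<^esub>, b') y = act' (\<one>\<^bsub>S\<^esub>, c') y" "act' (b', b') y = act' (c', c') y"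
      using t that by metis+
  qed
  show "b = c" if "b' = c'"
  proof (rule dom.faithful_eq [OF B(1,3)])
    fix x assume x: "x \<in> X"
    have "F (act (\<one>\<^bsub>S\<^esub>, b) x) = F (act (\<one>\<^bsub>S\<^esub>, c) x)" "F (act (b, b) x) = F (act (c, c) x)"
      using t that x by metis+
    then show "act (\<one>\<^bsub>S\<^esub>, b) x = act (\<one>\<^bsub>S\<^esub>, c) x" "act (b, b) x = act (c, c) x"
      using F_eq_iff dom.act_closed x B by simp_all
  qed
qed

text \<open>The left component of the solution at \<open>(x, y)\<close> is \<open>q = (1, lab x) y\<close>, and in the right
  component \<open>x\<close> is acted on by the inverse of \<open>(lab q, lab q)\<close>. For given \<open>x\<close> every point of \<open>X\<close>
  occurs as \<open>q\<close>, so \<open>F\<close> transports both kinds of elements at every label.\<close>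

lemma solution_map_transports_labels:
  assumes hom: "\<And>x y. x \<in> X \<Longrightarrow> y \<in> X \<Longrightarrow> cod.sol (F x, F y) = map_prod F F (dom.sol (x, y))"
    and z: "z \<in> X"
  shows "transports_brace (lab z) (lab' (F z))"
proof -
  have l: "lab x \<in> B" "lab' (F x) \<in> B" if "x \<in> X" for x
    using that dom.lab_closed cod.lab_closed F_closed by simp_all
  have g: "(\<one>\<^bsub>S\<^esub>, b) \<in> carrier G" "(b, b) \<in> carrier G" if "b \<in> B" for b using that by simp_all
  have 1: "F (act (\<one>\<^bsub>S\<^esub>, lab x) y) = act' (\<one>\<^bsub>S\<^esub>, lab' (F x)) (F y)" if "x \<in> X" "y \<in> X" for x y
    using hom [OF that] by (simp add: dom.sol_def cod.sol_def)
  have "F (act (lab z, lab z) x) = act' (lab' (F z), lab' (F z)) (F x)" if x: "x \<in> X" for x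
  proof -
    \<comment> \<open>The second component of the solution at \<open>(p, q)\<close> sees \<open>q\<close> only through \<open>f\<^sub>p(q)\<close>;
      here \<open>q\<close> is chosen so that \<open>f\<^sub>p(q) = z\<close>.\<close>
    define p where "p = act (lab z, lab z) x"
    define q where "q = act (inv\<^bsub>G\<^esub> (\<one>\<^bsub>S\<^esub>, lab p)) z"
    have p: "p \<in> X" unfolding p_def using x l z by (simp add: dom.act_closed)
    have q: "q \<in> X" unfolding q_def by (intro dom.act_closed semi.inv_closed g l p z)
    have fz: "act (\<one>\<^bsub>S\<^esub>, lab p) q = z"
      unfolding q_def by (intro dom.act_inv(1) g l p z)
    have w: "lam (lab p) (lab q) = lab z"
      using dom.lab_act_dot_part [of "lab p" q] fz l p q by simp
    have w': "lam (lab' (F p)) (lab' (F q)) = lab' (F z)"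
      using cod.lab_act_dot_part [of "lab' (F p)" "F q"] 1 [OF p q] fz l p q F_closed by simp
    have "F (act (inv\<^bsub>G\<^esub> (lab z, lab z)) p) = act' (inv\<^bsub>G\<^esub> (lab' (F z), lab' (F z))) (F p)"
      using hom [OF p q] by (simp add: dom.sol_def cod.sol_def w w')
    moreover have "act (inv\<^bsub>G\<^esub> (lab z, lab z)) p = x"
      unfolding p_def by (intro dom.act_inv(2) g l x z)
    ultimately show ?thesis
      using cod.act_inv(1) [OF g(2) [OF l(2) [OF z]] F_closed [OF p]] by (simp add: p_def)
  qed
  then show ?thesis
    unfolding transports_brace_def transports_def using l z g 1 by simp
qed

text \<open>The relation \<open>transports_brace\<close> contains all pairs of corresponding labels, so its domain and
  its range are \<open>\<cdot>\<close>-subgroups that contain all labels, hence are all of \<open>B\<close>.\<close>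

theorem solution_isomorphism_induces_automorphism:
  assumes hom: "\<And>x y. x \<in> X \<Longrightarrow> y \<in> X \<Longrightarrow> cod.sol (F x, F y) = map_prod F F (dom.sol (x, y))"
  obtains \<psi> where "brace_automorphism S M \<psi>"
    and "\<And>x. x \<in> X \<Longrightarrow> lab' (F x) = \<psi> (lab x)"
    and "\<And>g x. g \<in> carrier G \<Longrightarrow> x \<in> X \<Longrightarrow> F (act g x) = act' (map_prod \<psi> \<psi> g) (F x)"
proof -
  have lab: "transports_brace (lab z) (lab' (F z))" if "z \<in> X" for z
    by (rule solution_map_transports_labels) (use hom that in auto)
  have "{b. \<exists>b'. transports_brace b b'} = B"
  proof (rule dom.subgroup_containing_labels)
    show "subgroup {b. \<exists>b'. transports_brace b b'} M"
      using transports_brace_closed transports_brace_one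
      by (intro dot.subgroupI)
        (auto simp: carrier_eq intro: transports_brace_mult transports_brace_inv)
    show "lab ` X \<subseteq> {b. \<exists>b'. transports_brace b b'}" using lab by blast
  qed
  then have "\<forall>b\<in>B. \<exists>b'. transports_brace b b'" by blast
  then obtain \<psi> where \<psi>: "\<And>b. b \<in> B \<Longrightarrow> transports_brace b (\<psi> b)"
    using bchoice by metis
  have \<psi>_eq: "\<psi> b = b'" if "transports_brace b b'" for b b'
    using \<psi> that transports_brace_unique transports_brace_closed by blast
  have cl: "\<psi> b \<in> B" if "b \<in> B" for b using \<psi> [OF that] transports_brace_closed by blast
  have dot: "\<psi> (b \<bullet> c) = \<psi> b \<bullet> \<psi> c" if "b \<in> B" "c \<in> B" for b c
    using \<psi>_eq transports_brace_mult \<psi> that by blast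
  have labF: "lab' (F x) = \<psi> (lab x)" if "x \<in> X" for x
    using \<psi>_eq [OF lab [OF that]] by (rule sym)
  have \<psi>_one: "\<psi> \<one>\<^bsub>S\<^esub> = \<one>\<^bsub>S\<^esub>" using \<psi>_eq transports_brace_one by blast
  have inj: "inj_on \<psi> B" using \<psi> transports_brace_unique by (metis inj_onI)
  have "\<psi> ` B = B"
  proof (rule cod.subgroup_containing_labels)
    have "group_hom M M \<psi>"
      using dot cl by (auto simp: group_hom_def group_hom_axioms_def hom_def carrier_eq dot.is_group)
    then show "subgroup (\<psi> ` B) M"
      using group_hom.img_is_subgroup carrier_eq by metis
    show "lab' ` Y \<subseteq> \<psi> ` B" using F_surj labF dom.lab_closed by fastforce
  qed
  then have bij: "bij_betw \<psi> B B" using inj by (simp add: bij_betw_def)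
  have lam_lab: "\<psi> (lam b (lab x)) = lam (\<psi> b) (\<psi> (lab x))" if "b \<in> B" "x \<in> X" for b x
  proof -
    have "F (act (\<one>\<^bsub>S\<^esub>, b) x) = act' (\<one>\<^bsub>S\<^esub>, \<psi> b) (F x)"
      using \<psi> [OF that(1)] that unfolding transports_brace_def transports_def by blast
    then have "lab' (F (act (\<one>\<^bsub>S\<^esub>, b) x)) = lam (\<psi> b) (lab' (F x))"
      using cod.lab_act_dot_part F_closed cl that by simp
    then show ?thesis
      using labF dom.act_closed dom.lab_act_dot_part that by simp
  qed
  \<comment> \<open>A label is \<open>\<lambda>\<^sub>b\<close> of another label, so \<open>\<star>\<close>-multiplying by it on the right is
    \<open>\<cdot>\<close>-multiplying by that other label.\<close>
  have star_lab: "\<psi> (b \<oslash> lab x) = \<psi> b \<oslash> \<psi> (lab x)" if b: "b \<in> B" and x: "x \<in> X" for b x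
  proof -
    define x' where "x' = act (inv\<^bsub>G\<^esub> (\<one>\<^bsub>S\<^esub>, b)) x"
    have x': "x' \<in> X" unfolding x'_def using dom.act_closed b x by (simp add: inv_dot_part)
    have e: "lam b (lab x') = lab x"
      unfolding x'_def using dom.lab_act_dot_part b x dom.lab_closed by (simp add: inv_dot_part)
    have "b \<oslash> lab x = b \<bullet> lab x'" using b x' e dom.lab_closed by (simp add: dot_lam)
    then have "\<psi> (b \<oslash> lab x) = \<psi> b \<bullet> \<psi> (lab x')"
      using b x' dom.lab_closed dot by simp
    also have "\<dots> = \<psi> b \<oslash> \<psi> (lab x)"
      using b x' e lam_lab [OF b x'] dom.lab_closed cl by (simp add: dot_lam)
    finally show ?thesis .
  qed
  have "\<forall>b\<in>B. \<psi> (b \<oslash> c) = \<psi> b \<oslash> \<psi> c" if "c \<in> generate S (lab ` X)" for c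
    using that
  proof (induction rule: generate.induct)
    case one
    show ?case using cl \<psi>_one by simp
  next
    case (incl h)
    then show ?case using star_lab by blast
  next
    case (inv h)
    then obtain x where x: "x \<in> X" "h = lab x" by blast
    then have h: "h \<in> B" using dom.lab_closed by blast
    have *: "\<psi> (b \<oslash> inv\<^bsub>S\<^esub> h) = \<psi> b \<oslash> inv\<^bsub>S\<^esub> (\<psi> h)" if b: "b \<in> B" for b
    proof -
      have "\<psi> b = \<psi> (b \<oslash> inv\<^bsub>S\<^esub> h) \<oslash> \<psi> h"
        using star_lab [of "b \<oslash> inv\<^bsub>S\<^esub> h" x] b x h by (simp add: star.m_assoc)
      then show ?thesis using b h cl by (simp add: star.m_assoc)
    qed
    have "\<psi> (inv\<^bsub>S\<^esub> h) = inv\<^bsub>S\<^esub> (\<psi> h)" using * [of "\<one>\<^bsub>S\<^esub>"] \<psi>_one h cl by simp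
    then show ?case using * by simp
  next
    case (eng c d)
    then have "c \<in> B" "d \<in> B" using dom.lab_generate by auto
    then show ?case using eng.IH cl
      by (metis star.m_assoc star.m_closed)
  qed
  then have star: "\<psi> (b \<oslash> c) = \<psi> b \<oslash> \<psi> c" if "b \<in> B" "c \<in> B" for b c
    using that dom.lab_generate by simp
  have aut: "brace_automorphism S M \<psi>"
    unfolding brace_automorphism_def iso_def hom_def
    using star dot cl bij by (auto simp: carrier_eq)
  have "transports g (map_prod \<psi> \<psi> g)" if g: "g \<in> carrier G" for g
  proof -
    obtain b c where bc: "g = (b, c)" "b \<in> B" "c \<in> B" using g by auto
    define d where "d = inv\<^bsub>M\<^esub> b \<bullet> c"
    have d: "d \<in> B" using bc d_def by simp
    have gd: "g = (b, b) \<otimes>\<^bsub>G\<^esub> (\<one>\<^bsub>S\<^esub>, d)"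
      unfolding bc d_def using bc diag_dot_part_factor by blast
    have "map_prod \<psi> \<psi> g = (\<psi> b, \<psi> b) \<otimes>\<^bsub>G\<^esub> (\<one>\<^bsub>S\<^esub>, \<psi> d)"
      using bc d dot [of b d] cl by (simp add: d_def dot_cancel)
    then show ?thesis
      using gd transports_mult \<psi> [OF bc(2)] \<psi> [OF d] unfolding transports_brace_def by metis
  qed
  then show ?thesis using that [OF aut labF] unfolding transports_def by blast
qed

theorem equivariant_map_solution_isomorphism:
  assumes aut: "brace_automorphism S M \<psi>"
    and labF: "\<And>x. x \<in> X \<Longrightarrow> lab' (F x) = \<psi> (lab x)"
    and equi: "\<And>g x. g \<in> carrier G \<Longrightarrow> x \<in> X \<Longrightarrow> F (act g x) = act' (map_prod \<psi> \<psi> g) (F x)"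
    and x: "x \<in> X" and y: "y \<in> X"
  shows "cod.sol (F x, F y) = map_prod F F (dom.sol (x, y))"
proof -
  interpret \<Psi>: group_hom G G "map_prod \<psi> \<psi>"
    using brace_automorphism_semidirect [OF aut]
    by (simp add: group_hom_def group_hom_axioms_def iso_def semi.is_group)
  have l: "lab x \<in> B" "lab y \<in> B" using dom.lab_closed x y by auto
  define w where "w = lam (lab x) (lab y)"
  have w: "w \<in> B" using l by (simp add: w_def)
  have \<psi>w: "\<psi> w = lam (\<psi> (lab x)) (\<psi> (lab y))"
    unfolding w_def using brace_automorphism_lam [OF aut l] .
  have "\<psi> \<one>\<^bsub>S\<^esub> = \<one>\<^bsub>S\<^esub>" using \<Psi>.hom_one by (simp add: one_G)
  moreover have "map_prod \<psi> \<psi> (inv\<^bsub>G\<^esub> (w, w)) = inv\<^bsub>G\<^esub> (\<psi> w, \<psi> w)"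
    using \<Psi>.hom_inv [of "(w, w)"] w by simp
  moreover have "inv\<^bsub>G\<^esub> (w, w) \<in> carrier G" using w semi.inv_closed [of "(w, w)"] by simp
  ultimately show ?thesis
    using equi [of "(\<one>\<^bsub>S\<^esub>, lab x)" y] equi [of "inv\<^bsub>G\<^esub> (w, w)" x] labF x y l
    by (simp add: dom.sol_def cod.sol_def \<psi>w flip: w_def)
qed

end

section \<open>Families of coset spaces as labelled actions\<close>

definition coset_act ::
  "'b monoid \<Rightarrow> 'b monoid \<Rightarrow> 'b \<times> 'b \<Rightarrow> 'b set \<times> 'j \<times> ('b \<times> 'b) set \<Rightarrow>
    'b set \<times> 'j \<times> ('b \<times> 'b) set" where
  "coset_act S M g = (\<lambda>(i, j, C). (i, j, g <#\<^bsub>brace_semidirect S M\<^esub> C))"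

text \<open>The label of \<open>h K\<^sub>i\<^sub>,\<^sub>j\<close> is \<open>\<Theta>\<^sub>h(a\<^sub>i)\<close>; since \<open>K\<^sub>i\<^sub>,\<^sub>j\<close> stabilizes \<open>a\<^sub>i\<close>, any element of
  the coset may be chosen as \<open>h\<close>.\<close>

definition coset_label ::
  "'b monoid \<Rightarrow> 'b monoid \<Rightarrow> ('b set \<Rightarrow> 'b) \<Rightarrow> 'b set \<times> 'j \<times> ('b \<times> 'b) set \<Rightarrow> 'b" where
  "coset_label S M a = (\<lambda>(i, j, C). brace_action S M (SOME h. h \<in> C) (a i))"

locale coset_family = skew_left_brace S M
  for S M :: "'b monoid" +
  fixes a :: "'b set \<Rightarrow> 'b" and I :: "'b set set" and J :: "'b set \<Rightarrow> 'j set"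
    and K :: "'b set \<Rightarrow> 'j \<Rightarrow> ('b \<times> 'b) set"
  assumes I_orbits: "I \<subseteq> orbits (brace_semidirect S M) (carrier S) (brace_action S M)"
    and a_mem: "i \<in> I \<Longrightarrow> a i \<in> i"
    and I_generate: "generate S (\<Union>I) = carrier S"
    and J_nonempty: "i \<in> I \<Longrightarrow> J i \<noteq> {}"
    and K_sub: "\<lbrakk>i \<in> I; j \<in> J i\<rbrakk> \<Longrightarrow> subgroup (K i j) (brace_semidirect S M)"
    and K_stab: "\<lbrakk>i \<in> I; j \<in> J i\<rbrakk> \<Longrightarrow>
      K i j \<subseteq> stabilizer (brace_semidirect S M) (brace_action S M) (a i)"
    and trivial_core: "\<lbrakk>b \<in> carrier S;
      \<And>i j. i \<in> I \<Longrightarrow> j \<in> J i \<Longrightarrow> (\<one>\<^bsub>S\<^esub>, b) \<in> normal_core (brace_semidirect S M) (K i j);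
      \<And>i j. i \<in> I \<Longrightarrow> j \<in> J i \<Longrightarrow> (b, b) \<in> normal_core (brace_semidirect S M) (K i j)\<rbrakk> \<Longrightarrow>
      b = \<one>\<^bsub>S\<^esub>"
begin

abbreviation Cosets where "Cosets \<equiv> brace_sol_set S M I J K"
abbreviation cact :: "'b \<times> 'b \<Rightarrow> 'b set \<times> 'j \<times> ('b \<times> 'b) set \<Rightarrow> 'b set \<times> 'j \<times> ('b \<times> 'b) set"
  where "cact \<equiv> coset_act S M"
abbreviation clab :: "'b set \<times> 'j \<times> ('b \<times> 'b) set \<Rightarrow> 'b" where "clab \<equiv> coset_label S M a"

lemma orbit_of_representative:
  assumes "i \<in> I"
  shows "a i \<in> B" "i = (\<lambda>g. Th g (a i)) ` carrier G"
proof -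
  obtain x where x: "x \<in> B" and i: "i = orbit G Th x"
    using I_orbits assms unfolding orbits_def by blast
  obtain g where g: "g \<in> carrier G" "a i = Th g x"
    using a_mem [OF assms] i unfolding orbit_def by blast
  show "a i \<in> B" using g x Th_closed by simp
  have "Th h x = Th (h \<otimes>\<^bsub>G\<^esub> inv\<^bsub>G\<^esub> g) (a i)" if "h \<in> carrier G" for h
    using that g x Th_mult [of h "inv\<^bsub>G\<^esub> g" "Th g x"] semi.inv_closed [of g]
    by (simp del: carrier_G mult_G)
  moreover have "Th h (a i) = Th (h \<otimes>\<^bsub>G\<^esub> g) x" if "h \<in> carrier G" for h
    using that g x Th_mult by simp
  ultimately show "i = (\<lambda>g. Th g (a i)) ` carrier G"
    using g(1) semi.m_closed semi.inv_closed unfolding i orbit_def image_def by blast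
qed

lemma coset_cases:
  assumes "x \<in> Cosets"
  obtains i j h where "x = (i, j, h <#\<^bsub>G\<^esub> K i j)" "i \<in> I" "j \<in> J i" "h \<in> carrier G"
  using assms unfolding brace_sol_set_def LCOSETS_def by blast

lemma coset_I: "\<lbrakk>i \<in> I; j \<in> J i; h \<in> carrier G\<rbrakk> \<Longrightarrow> (i, j, h <#\<^bsub>G\<^esub> K i j) \<in> Cosets"
  unfolding brace_sol_set_def LCOSETS_def by blast

lemma act_coset:
  "\<lbrakk>i \<in> I; j \<in> J i; h \<in> carrier G; g \<in> carrier G\<rbrakk> \<Longrightarrow>
    cact g (i, j, h <#\<^bsub>G\<^esub> K i j) = (i, j, (g \<otimes>\<^bsub>G\<^esub> h) <#\<^bsub>G\<^esub> K i j)"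
  unfolding coset_act_def using semi.lcos_m_assoc [OF subgroup.subset [OF K_sub]] by simp

lemma label_coset:
  assumes i: "i \<in> I" and j: "j \<in> J i" and h: "h \<in> carrier G"
  shows "clab (i, j, h <#\<^bsub>G\<^esub> K i j) = Th h (a i)"
proof -
  have "h \<in> h <#\<^bsub>G\<^esub> K i j" using semi.lcos_self [OF h K_sub [OF i j]] .
  then have "(SOME h'. h' \<in> h <#\<^bsub>G\<^esub> K i j) \<in> h <#\<^bsub>G\<^esub> K i j" by (rule someI)
  then obtain k where k: "k \<in> K i j" "(SOME h'. h' \<in> h <#\<^bsub>G\<^esub> K i j) = h \<otimes>\<^bsub>G\<^esub> k"
    unfolding l_coset_def by blast
  have "Th k (a i) = a i" "k \<in> carrier G"
    using k K_stab [OF i j] unfolding stabilizer_def by blast+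
  then show ?thesis
    unfolding coset_label_def using k h Th_mult orbit_of_representative(1) [OF i] by simp
qed

lemma act_fixes_coset_iff:
  assumes "i \<in> I" "j \<in> J i" "h \<in> carrier G" "g \<in> carrier G"
  shows "cact g (i, j, h <#\<^bsub>G\<^esub> K i j) = (i, j, h <#\<^bsub>G\<^esub> K i j) \<longleftrightarrow>
    g \<in> h <#\<^bsub>G\<^esub> K i j #>\<^bsub>G\<^esub> inv\<^bsub>G\<^esub> h"
  using semi.lcos_stabilizer [OF K_sub [OF assms(1,2)] assms(3,4)] act_coset [OF assms] by simp

lemma fixes_all_in_cores:
  assumes "g \<in> carrier G" "\<And>x. x \<in> Cosets \<Longrightarrow> cact g x = x" "i \<in> I" "j \<in> J i"
  shows "g \<in> normal_core G (K i j)"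
  unfolding normal_core_def using act_fixes_coset_iff coset_I assms by blast

sublocale labelled_action S M Cosets cact clab
proof unfold_locales
  fix g h x assume g: "g \<in> carrier G" and h: "h \<in> carrier G" and x: "x \<in> Cosets"
  obtain i j k where x': "x = (i, j, k <#\<^bsub>G\<^esub> K i j)" "i \<in> I" "j \<in> J i" "k \<in> carrier G"
    using x by (rule coset_cases)
  have "cact h x = (i, j, (h \<otimes>\<^bsub>G\<^esub> k) <#\<^bsub>G\<^esub> K i j)" using act_coset x' h by simp
  moreover have "cact g (i, j, (h \<otimes>\<^bsub>G\<^esub> k) <#\<^bsub>G\<^esub> K i j) = (i, j, (g \<otimes>\<^bsub>G\<^esub> (h \<otimes>\<^bsub>G\<^esub> k)) <#\<^bsub>G\<^esub> K i j)"
    by (intro act_coset x' semi.m_closed g h)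
  moreover have "cact (g \<otimes>\<^bsub>G\<^esub> h) x = (i, j, (g \<otimes>\<^bsub>G\<^esub> h \<otimes>\<^bsub>G\<^esub> k) <#\<^bsub>G\<^esub> K i j)"
    unfolding x'(1) by (intro act_coset x' semi.m_closed g h)
  ultimately show "cact (g \<otimes>\<^bsub>G\<^esub> h) x = cact g (cact h x)"
    using semi.m_assoc [OF g h x'(4)] by metis
next
  fix g x assume g: "g \<in> carrier G" and x: "x \<in> Cosets"
  obtain i j k where x': "x = (i, j, k <#\<^bsub>G\<^esub> K i j)" "i \<in> I" "j \<in> J i" "k \<in> carrier G"
    using x by (rule coset_cases)
  have gk: "g \<otimes>\<^bsub>G\<^esub> k \<in> carrier G" using g x'(4) by (rule semi.m_closed)
  have gx: "cact g x = (i, j, (g \<otimes>\<^bsub>G\<^esub> k) <#\<^bsub>G\<^esub> K i j)" using act_coset x' g by simp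
  show "cact g x \<in> Cosets" unfolding gx using x' gk by (intro coset_I)
  show "clab (cact g x) = Th g (clab x)"
    using label_coset [OF x'(2,3) gk] label_coset [OF x'(2-4)]
      Th_mult [OF g x'(4) orbit_of_representative(1) [OF x'(2)]]
    unfolding gx unfolding x'(1) by simp
next
  fix x assume x: "x \<in> Cosets"
  obtain i j k where x': "x = (i, j, k <#\<^bsub>G\<^esub> K i j)" "i \<in> I" "j \<in> J i" "k \<in> carrier G"
    using x by (rule coset_cases)
  show "cact \<one>\<^bsub>G\<^esub> x = x"
    unfolding x'(1) act_coset [OF x'(2-4) semi.one_closed] using x'(4) by (simp only: semi.l_one)
  show "clab x \<in> B"
    unfolding x'(1) label_coset [OF x'(2-4)] using x' orbit_of_representative Th_closed by blast
next
  have "clab ` Cosets = \<Union>I"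
  proof
    show "clab ` Cosets \<subseteq> \<Union>I"
    proof
      fix l assume "l \<in> clab ` Cosets"
      then obtain x where "x \<in> Cosets" and l: "l = clab x" by blast
      then obtain i j k where x': "x = (i, j, k <#\<^bsub>G\<^esub> K i j)" "i \<in> I" "j \<in> J i" "k \<in> carrier G"
        using coset_cases by metis
      then show "l \<in> \<Union>I" using l label_coset orbit_of_representative(2) by blast
    qed
    show "\<Union>I \<subseteq> clab ` Cosets"
    proof
      fix l assume "l \<in> \<Union>I"
      then obtain i where i: "i \<in> I" "l \<in> i" by blast
      then obtain g where g: "g \<in> carrier G" "l = Th g (a i)" using orbit_of_representative(2) by blast
      obtain j where "j \<in> J i" using J_nonempty i by blast
      then have "l = clab (i, j, g <#\<^bsub>G\<^esub> K i j)" "(i, j, g <#\<^bsub>G\<^esub> K i j) \<in> Cosets"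
        using i g label_coset coset_I by simp_all
      then show "l \<in> clab ` Cosets" by blast
    qed
  qed
  then show "generate S (clab ` Cosets) = B" using I_generate by simp
next
  fix b assume b: "b \<in> B"
    and fix1: "\<And>x. x \<in> Cosets \<Longrightarrow> cact (\<one>\<^bsub>S\<^esub>, b) x = x" and fix2: "\<And>x. x \<in> Cosets \<Longrightarrow> cact (b, b) x = x"
  show "b = \<one>\<^bsub>S\<^esub>"
    by (rule trivial_core [OF b])
      (use fixes_all_in_cores [of "(\<one>\<^bsub>S\<^esub>, b)", OF _ fix1] fixes_all_in_cores [of "(b, b)", OF _ fix2] b
        in auto)
qed

lemma sol_eq_brace_sol_map:
  assumes "x \<in> Cosets" "y \<in> Cosets"
  shows "brace_sol_map S M a K (x, y) = sol (x, y)"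
proof -
  obtain i j h where x: "x = (i, j, h <#\<^bsub>G\<^esub> K i j)" "i \<in> I" "j \<in> J i" "h \<in> carrier G"
    using assms(1) by (rule coset_cases)
  obtain i' j' h' where y: "y = (i', j', h' <#\<^bsub>G\<^esub> K i' j')" "i' \<in> I" "j' \<in> J i'" "h' \<in> carrier G"
    using assms(2) by (rule coset_cases)
  have l: "clab x = Th h (a i)" "clab y = Th h' (a i')" using x y label_coset by simp_all
  have lB: "clab x \<in> B" "clab y \<in> B" using assms lab_closed by simp_all
  then have w: "Th (\<one>\<^bsub>S\<^esub>, clab x) (clab y) = lam (clab x) (clab y)" by (simp add: Th_pair)
  have g: "(\<one>\<^bsub>S\<^esub>, clab x) \<in> carrier G"
    "inv\<^bsub>G\<^esub> (lam (clab x) (clab y), lam (clab x) (clab y)) \<in> carrier G"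
    using lB semi.inv_closed [of "(lam (clab x) (clab y), lam (clab x) (clab y))"] by simp_all
  have "brace_sol_map S M a K (x, y) =
    ((i', j', ((\<one>\<^bsub>S\<^esub>, clab x) \<otimes>\<^bsub>G\<^esub> h') <#\<^bsub>G\<^esub> K i' j'),
     (i, j, (inv\<^bsub>G\<^esub> (lam (clab x) (clab y), lam (clab x) (clab y)) \<otimes>\<^bsub>G\<^esub> h) <#\<^bsub>G\<^esub> K i j))"
    using brace_sol_map_rep [of I a J K i j h i' j' h', OF orbit_of_representative(1) K_sub K_stab x(2-4) y(2-4)]
    unfolding x(1) [symmetric] y(1) [symmetric] l [symmetric] w by blast
  also have "\<dots> = (cact (\<one>\<^bsub>S\<^esub>, clab x) y,
      cact (inv\<^bsub>G\<^esub> (lam (clab x) (clab y), lam (clab x) (clab y))) x)"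
    using act_coset [OF y(2-4) g(1)] act_coset [OF x(2-4) g(2)] x(1) y(1) by metis
  finally show ?thesis by (simp add: sol_def)
qed

end

section \<open>Equivariant bijections between families of coset spaces\<close>

locale coset_family_pair = skew_left_brace S M +
  dom: coset_family S M a I J K + cod: coset_family S M a I' J' L
  for S M :: "'b monoid"
    and a :: "'b set \<Rightarrow> 'b"
    and I :: "'b set set" and J :: "'b set \<Rightarrow> 'j set" and K :: "'b set \<Rightarrow> 'j \<Rightarrow> ('b \<times> 'b) set"
    and I' :: "'b set set" and J' :: "'b set \<Rightarrow> 'k set" and L :: "'b set \<Rightarrow> 'k \<Rightarrow> ('b \<times> 'b) set"
begin

text \<open>The pair of families \<open>y\<close>, \<open>z\<close> is kept as a single family \<open>t\<close> of elements of \<open>G\<close>: the image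
  of the base point of component \<open>(i, j)\<close> is the coset of \<open>t i j\<close>.\<close>

definition matching ::
  "('b \<Rightarrow> 'b) \<Rightarrow> ('b set \<Rightarrow> 'b set) \<Rightarrow> ('b set \<Rightarrow> 'j \<Rightarrow> 'k) \<Rightarrow> ('b set \<Rightarrow> 'j \<Rightarrow> 'b \<times> 'b) \<Rightarrow> bool" where
  "matching \<psi> \<alpha> \<beta> t \<longleftrightarrow> brace_automorphism S M \<psi> \<and> bij_betw \<alpha> I I' \<and>
    (\<forall>i\<in>I. bij_betw (\<beta> i) (J i) (J' (\<alpha> i))) \<and>
    (\<forall>i\<in>I. \<forall>j\<in>J i. t i j \<in> carrier G \<and> \<psi> (a i) = Th (t i j) (a (\<alpha> i)) \<and>
      map_prod \<psi> \<psi> ` K i j = t i j <#\<^bsub>G\<^esub> L (\<alpha> i) (\<beta> i j) #>\<^bsub>G\<^esub> inv\<^bsub>G\<^esub> (t i j))"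

text \<open>The map is \<open>h K\<^sub>i\<^sub>,\<^sub>j \<mapsto> \<Psi>(h) t\<^sub>i\<^sub>,\<^sub>j L\<close> with \<open>\<Psi> = \<psi> \<times> \<psi>\<close>. It is well defined because
  \<open>\<Psi>(K\<^sub>i\<^sub>,\<^sub>j) t\<^sub>i\<^sub>,\<^sub>j = t\<^sub>i\<^sub>,\<^sub>j L\<close>, and it respects labels because
  \<open>\<Theta>\<^bsub>\<Psi>(h)\<^esub> (\<Theta>\<^bsub>t\<^esub>(a\<^bsub>\<alpha>(i)\<^esub>)) = \<Theta>\<^bsub>\<Psi>(h)\<^esub>(\<psi>(a\<^sub>i)) = \<psi>(\<Theta>\<^sub>h(a\<^sub>i))\<close>.\<close>

theorem matching_imp_isomorphic:
  assumes match: "matching \<psi> \<alpha> \<beta> t"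
  shows "yb_isomorphic dom.Cosets (brace_sol_map S M a K) cod.Cosets (brace_sol_map S M a L)"
proof -
  let ?\<Psi> = "map_prod \<psi> \<psi>"
  have aut: "brace_automorphism S M \<psi>" and \<alpha>: "bij_betw \<alpha> I I'"
    and \<beta>: "\<And>i. i \<in> I \<Longrightarrow> bij_betw (\<beta> i) (J i) (J' (\<alpha> i))"
    and t: "\<And>i j. i \<in> I \<Longrightarrow> j \<in> J i \<Longrightarrow> t i j \<in> carrier G"
    and rep: "\<And>i j. i \<in> I \<Longrightarrow> j \<in> J i \<Longrightarrow> \<psi> (a i) = Th (t i j) (a (\<alpha> i))"
    and conj: "\<And>i j. i \<in> I \<Longrightarrow> j \<in> J i \<Longrightarrow>
      ?\<Psi> ` K i j = t i j <#\<^bsub>G\<^esub> L (\<alpha> i) (\<beta> i j) #>\<^bsub>G\<^esub> inv\<^bsub>G\<^esub> (t i j)"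
    using match unfolding matching_def by blast+
  have iso: "?\<Psi> \<in> iso G G" by (rule brace_automorphism_semidirect [OF aut])
  interpret \<Psi>: group_hom G G ?\<Psi>
    using iso by (simp add: group_hom_def group_hom_axioms_def iso_def semi.is_group)
  have \<Psi>_bij: "bij_betw ?\<Psi> (carrier G) (carrier G)" using iso by (simp add: iso_def)
  have \<Psi>_closed: "?\<Psi> g \<in> carrier G" if "g \<in> carrier G" for g
    using \<Psi>_bij that unfolding bij_betw_def by blast
  have \<alpha>I: "\<alpha> i \<in> I'" if "i \<in> I" for i using \<alpha> that by (auto simp: bij_betw_def)
  have \<beta>J: "\<beta> i j \<in> J' (\<alpha> i)" if "i \<in> I" "j \<in> J i" for i j
    using \<beta> that by (auto simp: bij_betw_def)
  have KG: "K i j \<subseteq> carrier G" if "i \<in> I" "j \<in> J i" for i j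
    using subgroup.subset dom.K_sub that by blast
  have LG: "L (\<alpha> i) (\<beta> i j) \<subseteq> carrier G" if "i \<in> I" "j \<in> J i" for i j
    using subgroup.subset cod.K_sub \<alpha>I \<beta>J that by blast
  \<comment> \<open>Translating the image of a whole coset avoids choosing a representative:
    \<open>\<Psi>(h K) t = \<Psi>(h) (t L t\<^sup>-\<^sup>1) t = \<Psi>(h) t L\<close>.\<close>
  define F :: "'b set \<times> 'j \<times> ('b \<times> 'b) set \<Rightarrow> 'b set \<times> 'k \<times> ('b \<times> 'b) set" where
    "F = (\<lambda>(i, j, C). (\<alpha> i, \<beta> i j, ?\<Psi> ` C #>\<^bsub>G\<^esub> t i j))"
  have F: "F (i, j, h <#\<^bsub>G\<^esub> K i j) = (\<alpha> i, \<beta> i j, (?\<Psi> h \<otimes>\<^bsub>G\<^esub> t i j) <#\<^bsub>G\<^esub> L (\<alpha> i) (\<beta> i j))"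
    if "i \<in> I" "j \<in> J i" "h \<in> carrier G" for i j h
    using \<Psi>.image_lcos [OF that(3) KG [OF that(1,2)]] conj [OF that(1,2)]
      semi.conjugate_lcos [OF LG [OF that(1,2)] t [OF that(1,2)] \<Psi>_closed [OF that(3)]]
    by (simp add: F_def)
  have F_inj: "inj_on F dom.Cosets"
  proof (rule inj_onI)
    fix x x' assume x: "x \<in> dom.Cosets" and x': "x' \<in> dom.Cosets" and eq: "F x = F x'"
    obtain i j h where ijh: "x = (i, j, h <#\<^bsub>G\<^esub> K i j)" "i \<in> I" "j \<in> J i" "h \<in> carrier G"
      using x by (rule dom.coset_cases)
    obtain i' j' h' where ijh': "x' = (i', j', h' <#\<^bsub>G\<^esub> K i' j')" "i' \<in> I" "j' \<in> J i'" "h' \<in> carrier G"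
      using x' by (rule dom.coset_cases)
    have "\<alpha> i = \<alpha> i'" using eq ijh ijh' F by simp
    then have i': "i' = i" using \<alpha> ijh ijh' by (auto simp: bij_betw_def inj_on_def)
    have "\<beta> i j = \<beta> i j'" using eq ijh ijh' F i' by simp
    then have j': "j' = j" using \<beta> [OF ijh(2)] ijh ijh' i' by (auto simp: bij_betw_def inj_on_def)
    have "?\<Psi> ` (h <#\<^bsub>G\<^esub> K i j) #>\<^bsub>G\<^esub> t i j = ?\<Psi> ` (h' <#\<^bsub>G\<^esub> K i j) #>\<^bsub>G\<^esub> t i j"
      using eq ijh ijh' i' j' by (simp add: F_def)
    moreover have sub: "k <#\<^bsub>G\<^esub> K i j \<subseteq> carrier G" if "k \<in> carrier G" for k
      by (rule semi.l_coset_subset_G [OF KG [OF ijh(2,3)] that])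
    moreover have "?\<Psi> ` (k <#\<^bsub>G\<^esub> K i j) \<subseteq> carrier G" if "k \<in> carrier G" for k
      by (rule image_subsetI, rule \<Psi>_closed, rule subsetD [OF sub [OF that]])
    ultimately have "?\<Psi> ` (h <#\<^bsub>G\<^esub> K i j) = ?\<Psi> ` (h' <#\<^bsub>G\<^esub> K i j)"
      using semi.rcoset_inv_cancel [OF _ t [OF ijh(2,3)]] ijh(4) ijh'(4) by metis
    then have "h <#\<^bsub>G\<^esub> K i j = h' <#\<^bsub>G\<^esub> K i j"
      using inj_on_image_eq_iff [OF bij_betw_imp_inj_on [OF \<Psi>_bij]] sub ijh(4) ijh'(4) by metis
    then show "x = x'" using ijh ijh' i' j' by simp
  qed
  have F_image: "F ` dom.Cosets = cod.Cosets"
  proof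
    show "F ` dom.Cosets \<subseteq> cod.Cosets"
    proof
      fix q assume "q \<in> F ` dom.Cosets"
      then obtain x where x: "x \<in> dom.Cosets" "q = F x" by blast
      obtain i j h where ijh: "x = (i, j, h <#\<^bsub>G\<^esub> K i j)" "i \<in> I" "j \<in> J i" "h \<in> carrier G"
        using x(1) by (rule dom.coset_cases)
      show "q \<in> cod.Cosets"
        unfolding x(2) ijh(1) F [OF ijh(2-4)]
        by (intro cod.coset_I \<alpha>I \<beta>J semi.m_closed \<Psi>_closed t ijh)
    qed
    show "cod.Cosets \<subseteq> F ` dom.Cosets"
    proof
      fix q assume "q \<in> cod.Cosets"
      then obtain i' j' k where q: "q = (i', j', k <#\<^bsub>G\<^esub> L i' j')" "i' \<in> I'" "j' \<in> J' i'" "k \<in> carrier G"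
        by (rule cod.coset_cases)
      obtain i where i: "i \<in> I" "i' = \<alpha> i" using \<alpha> q(2) by (auto simp: bij_betw_def)
      obtain j where j: "j \<in> J i" "j' = \<beta> i j" using \<beta> [OF i(1)] q(3) i by (auto simp: bij_betw_def)
      have "k \<otimes>\<^bsub>G\<^esub> inv\<^bsub>G\<^esub> (t i j) \<in> carrier G"
        by (intro semi.m_closed semi.inv_closed q t i j)
      then obtain h where h: "h \<in> carrier G" "?\<Psi> h = k \<otimes>\<^bsub>G\<^esub> inv\<^bsub>G\<^esub> (t i j)"
        using bij_betw_imp_surj_on [OF \<Psi>_bij] by (metis imageE)
      have "?\<Psi> h \<otimes>\<^bsub>G\<^esub> t i j = k"
        unfolding h(2) by (rule semi.mult_inv_cancel [OF q(4) t [OF i(1) j(1)]])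
      then have "q = F (i, j, h <#\<^bsub>G\<^esub> K i j)" using F [OF i(1) j(1) h(1)] q(1) i j by simp
      then show "q \<in> F ` dom.Cosets" using dom.coset_I [OF i(1) j(1) h(1)] by blast
    qed
  qed
  interpret labelled_action_pair S M dom.Cosets dom.cact dom.clab cod.Cosets cod.cact cod.clab F
    by unfold_locales (use F_inj F_image in \<open>simp add: bij_betw_def\<close>)
  have lab: "cod.clab (F x) = \<psi> (dom.clab x)" if x: "x \<in> dom.Cosets" for x
  proof -
    obtain i j h where ijh: "x = (i, j, h <#\<^bsub>G\<^esub> K i j)" "i \<in> I" "j \<in> J i" "h \<in> carrier G"
      using x by (rule dom.coset_cases)
    have "cod.clab (F x) = Th (?\<Psi> h \<otimes>\<^bsub>G\<^esub> t i j) (a (\<alpha> i))"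
      unfolding ijh(1) F [OF ijh(2-4)]
      by (intro cod.label_coset \<alpha>I \<beta>J semi.m_closed \<Psi>_closed t ijh)
    also have "\<dots> = Th (?\<Psi> h) (\<psi> (a i))"
      unfolding rep [OF ijh(2,3)]
      by (intro Th_mult \<Psi>_closed t ijh cod.orbit_of_representative \<alpha>I)
    also have "\<dots> = \<psi> (Th h (a i))"
      using brace_automorphism_Th [OF aut ijh(4) dom.orbit_of_representative(1) [OF ijh(2)]] by simp
    also have "Th h (a i) = dom.clab x"
      unfolding ijh(1) by (rule dom.label_coset [OF ijh(2-4), symmetric])
    finally show ?thesis .
  qed
  have equi: "F (dom.cact g x) = cod.cact (?\<Psi> g) (F x)" if g: "g \<in> carrier G" and x: "x \<in> dom.Cosets" for g x
  proof -
    obtain i j h where ijh: "x = (i, j, h <#\<^bsub>G\<^esub> K i j)" "i \<in> I" "j \<in> J i" "h \<in> carrier G"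
      using x by (rule dom.coset_cases)
    have th: "?\<Psi> h \<otimes>\<^bsub>G\<^esub> t i j \<in> carrier G" by (intro semi.m_closed \<Psi>_closed t ijh)
    have "F (dom.cact g x) = (\<alpha> i, \<beta> i j, (?\<Psi> (g \<otimes>\<^bsub>G\<^esub> h) \<otimes>\<^bsub>G\<^esub> t i j) <#\<^bsub>G\<^esub> L (\<alpha> i) (\<beta> i j))"
      unfolding ijh(1) dom.act_coset [OF ijh(2-4) g]
      by (intro F semi.m_closed g ijh)
    also have "?\<Psi> (g \<otimes>\<^bsub>G\<^esub> h) \<otimes>\<^bsub>G\<^esub> t i j = ?\<Psi> g \<otimes>\<^bsub>G\<^esub> (?\<Psi> h \<otimes>\<^bsub>G\<^esub> t i j)"
      using \<Psi>.hom_mult [OF g ijh(4)]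
        semi.m_assoc [OF \<Psi>_closed [OF g] \<Psi>_closed [OF ijh(4)] t [OF ijh(2,3)]] by metis
    also have "(\<alpha> i, \<beta> i j, \<dots> <#\<^bsub>G\<^esub> L (\<alpha> i) (\<beta> i j)) = cod.cact (?\<Psi> g) (F x)"
      unfolding ijh(1) F [OF ijh(2-4)]
      by (rule cod.act_coset [symmetric]) (intro \<alpha>I \<beta>J ijh th \<Psi>_closed g)+
    finally show ?thesis .
  qed
  have "brace_sol_map S M a L (F x, F y) = map_prod F F (brace_sol_map S M a K (x, y))"
    if x: "x \<in> dom.Cosets" and y: "y \<in> dom.Cosets" for x y
    using equivariant_map_solution_isomorphism [OF aut lab equi x y]
      dom.sol_eq_brace_sol_map [OF x y] cod.sol_eq_brace_sol_map [OF F_closed [OF x] F_closed [OF y]]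
    by simp
  then show ?thesis unfolding yb_isomorphic_def using F_bij by blast
qed

text \<open>An equivariant bijection is determined by the images of the base points, one in each component;
  components and stabilizers of these images must correspond to those of the base points.\<close>

theorem isomorphic_imp_matching:
  assumes "yb_isomorphic dom.Cosets (brace_sol_map S M a K) cod.Cosets (brace_sol_map S M a L)"
  obtains \<psi> \<alpha> \<beta> t where "matching \<psi> \<alpha> \<beta> t"
proof -
  obtain F where F_bij: "bij_betw F dom.Cosets cod.Cosets"
    and F_map: "\<And>x y. x \<in> dom.Cosets \<Longrightarrow> y \<in> dom.Cosets \<Longrightarrow>
      brace_sol_map S M a L (F x, F y) = map_prod F F (brace_sol_map S M a K (x, y))"
    using assms unfolding yb_isomorphic_def by blast
  interpret labelled_action_pair S M dom.Cosets dom.cact dom.clab cod.Cosets cod.cact cod.clab F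
    by unfold_locales (rule F_bij)
  have F_sol: "cod.sol (F x, F y) = map_prod F F (dom.sol (x, y))"
    if x: "x \<in> dom.Cosets" and y: "y \<in> dom.Cosets" for x y
    using F_map [OF x y] dom.sol_eq_brace_sol_map [OF x y]
      cod.sol_eq_brace_sol_map [OF F_closed [OF x] F_closed [OF y]] by simp
  obtain \<psi> where aut: "brace_automorphism S M \<psi>"
    and lab: "\<And>x. x \<in> dom.Cosets \<Longrightarrow> cod.clab (F x) = \<psi> (dom.clab x)"
    and equi: "\<And>g x. g \<in> carrier G \<Longrightarrow> x \<in> dom.Cosets \<Longrightarrow>
      F (dom.cact g x) = cod.cact (map_prod \<psi> \<psi> g) (F x)"
    using solution_isomorphism_induces_automorphism [OF F_sol] by blast
  let ?\<Psi> = "map_prod \<psi> \<psi>"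
  have iso: "?\<Psi> \<in> iso G G" by (rule brace_automorphism_semidirect [OF aut])
  have \<Psi>_bij: "bij_betw ?\<Psi> (carrier G) (carrier G)" using iso by (simp add: iso_def)
  have \<Psi>_closed: "?\<Psi> g \<in> carrier G" if "g \<in> carrier G" for g
    using bij_betw_apply [OF \<Psi>_bij that] .
  have \<Psi>_surj: "\<exists>h\<in>carrier G. g = ?\<Psi> h" if "g \<in> carrier G" for g
    using bij_betw_imp_surj_on [OF \<Psi>_bij] that by (metis imageE)
  have base_I: "(i, j, \<one>\<^bsub>G\<^esub> <#\<^bsub>G\<^esub> K i j) \<in> dom.Cosets" if "i \<in> I" "j \<in> J i" for i j
    by (intro dom.coset_I that semi.one_closed)
  \<comment> \<open>The image of the base point has label \<open>\<psi> (a i)\<close>, and a label in the orbit \<open>\<psi> ` i\<close>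
    occurs only over that orbit.\<close>
  have ex: "\<psi> ` i \<in> I' \<and> (\<exists>j'\<in>J' (\<psi> ` i). \<exists>h\<in>carrier G.
      F (i, j, \<one>\<^bsub>G\<^esub> <#\<^bsub>G\<^esub> K i j) = (\<psi> ` i, j', h <#\<^bsub>G\<^esub> L (\<psi> ` i) j') \<and> \<psi> (a i) = Th h (a (\<psi> ` i)))"
    if i: "i \<in> I" and j: "j \<in> J i" for i j
  proof -
    obtain i' j' h where q: "F (i, j, \<one>\<^bsub>G\<^esub> <#\<^bsub>G\<^esub> K i j) = (i', j', h <#\<^bsub>G\<^esub> L i' j')"
      "i' \<in> I'" "j' \<in> J' i'" "h \<in> carrier G"
      using F_closed [OF base_I [OF i j]] by (rule cod.coset_cases)
    have ai: "a i \<in> B" "a i' \<in> B"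
      using dom.orbit_of_representative(1) [OF i] cod.orbit_of_representative(1) [OF q(2)] by auto
    have rep: "\<psi> (a i) = Th h (a i')"
      using lab [OF base_I [OF i j]] dom.label_coset [OF i j semi.one_closed] cod.label_coset [OF q(2-4)]
        q(1) ai by simp
    have "\<psi> ` i = i'"
    proof -
      have img: "\<psi> (Th g (a i)) = Th (?\<Psi> g \<otimes>\<^bsub>G\<^esub> h) (a i')" if "g \<in> carrier G" for g
        using brace_automorphism_Th [OF aut that ai(1)] rep Th_mult [OF \<Psi>_closed [OF that] q(4) ai(2)]
        by simp
      have "\<psi> ` i = (\<lambda>g. \<psi> (Th g (a i))) ` carrier G"
        by (subst dom.orbit_of_representative(2) [OF i]) (simp only: image_image)
      also have "\<dots> = (\<lambda>g. Th g (a i')) ` carrier G"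
      proof
        show "(\<lambda>g. \<psi> (Th g (a i))) ` carrier G \<subseteq> (\<lambda>g. Th g (a i')) ` carrier G"
          using img \<Psi>_closed q(4) semi.m_closed by (auto simp del: carrier_G mult_G)
        show "(\<lambda>g. Th g (a i')) ` carrier G \<subseteq> (\<lambda>g. \<psi> (Th g (a i))) ` carrier G"
        proof (rule image_subsetI)
          fix g assume g: "g \<in> carrier G"
          then obtain k where k: "k \<in> carrier G" "g \<otimes>\<^bsub>G\<^esub> inv\<^bsub>G\<^esub> h = ?\<Psi> k"
            using \<Psi>_surj [OF semi.m_closed [OF g semi.inv_closed [OF q(4)]]] by blast
          have "?\<Psi> k \<otimes>\<^bsub>G\<^esub> h = g"
            using semi.mult_inv_cancel [OF g q(4)] k(2) by simp
          then show "Th g (a i') \<in> (\<lambda>g. \<psi> (Th g (a i))) ` carrier G"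
            using img [OF k(1)] k(1) by (metis imageI)
        qed
      qed
      also have "\<dots> = i'" by (rule cod.orbit_of_representative(2) [OF q(2), symmetric])
      finally show ?thesis .
    qed
    then show ?thesis using q rep by blast
  qed
  define \<alpha> where "\<alpha> i = \<psi> ` i" for i
  have "\<forall>i j. \<exists>p. i \<in> I \<and> j \<in> J i \<longrightarrow> fst p \<in> J' (\<alpha> i) \<and> snd p \<in> carrier G \<and>
      F (i, j, \<one>\<^bsub>G\<^esub> <#\<^bsub>G\<^esub> K i j) = (\<alpha> i, fst p, snd p <#\<^bsub>G\<^esub> L (\<alpha> i) (fst p)) \<and>
      \<psi> (a i) = Th (snd p) (a (\<alpha> i))"
    unfolding \<alpha>_def using ex by (metis fst_conv snd_conv)
  then obtain p where p: "\<And>i j. i \<in> I \<Longrightarrow> j \<in> J i \<Longrightarrow> fst (p i j) \<in> J' (\<alpha> i) \<and> snd (p i j) \<in> carrier G \<and>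
      F (i, j, \<one>\<^bsub>G\<^esub> <#\<^bsub>G\<^esub> K i j) = (\<alpha> i, fst (p i j), snd (p i j) <#\<^bsub>G\<^esub> L (\<alpha> i) (fst (p i j))) \<and>
      \<psi> (a i) = Th (snd (p i j)) (a (\<alpha> i))"
    by metis
  define \<beta> t where "\<beta> i j = fst (p i j)" and "t i j = snd (p i j)" for i j
  have \<alpha>I: "\<alpha> i \<in> I'" if "i \<in> I" for i
    using ex [OF that] dom.J_nonempty [OF that] unfolding \<alpha>_def by blast
  have \<beta>J: "\<beta> i j \<in> J' (\<alpha> i)" and t: "t i j \<in> carrier G"
    and base: "F (i, j, \<one>\<^bsub>G\<^esub> <#\<^bsub>G\<^esub> K i j) = (\<alpha> i, \<beta> i j, t i j <#\<^bsub>G\<^esub> L (\<alpha> i) (\<beta> i j))"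
    and rep: "\<psi> (a i) = Th (t i j) (a (\<alpha> i))"
    if "i \<in> I" "j \<in> J i" for i j
    using p [OF that] unfolding \<beta>_def t_def by blast+
  have F: "F (i, j, h <#\<^bsub>G\<^esub> K i j) = (\<alpha> i, \<beta> i j, (?\<Psi> h \<otimes>\<^bsub>G\<^esub> t i j) <#\<^bsub>G\<^esub> L (\<alpha> i) (\<beta> i j))"
    if ij: "i \<in> I" "j \<in> J i" and h: "h \<in> carrier G" for i j h
  proof -
    have "(i, j, h <#\<^bsub>G\<^esub> K i j) = dom.cact h (i, j, \<one>\<^bsub>G\<^esub> <#\<^bsub>G\<^esub> K i j)"
      using dom.act_coset [OF ij semi.one_closed h] semi.r_one [OF h] by simp
    then show ?thesis
      using equi [OF h base_I [OF ij]] base [OF ij]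
        cod.act_coset [OF \<alpha>I [OF ij(1)] \<beta>J [OF ij] t [OF ij] \<Psi>_closed [OF h]] by simp
  qed
  have hit: "\<exists>i\<in>I. \<exists>j\<in>J i. i' = \<alpha> i \<and> j' = \<beta> i j" if "i' \<in> I'" "j' \<in> J' i'" for i' j'
  proof -
    have "(i', j', \<one>\<^bsub>G\<^esub> <#\<^bsub>G\<^esub> L i' j') \<in> cod.Cosets" by (intro cod.coset_I that semi.one_closed)
    then obtain x where x: "x \<in> dom.Cosets" "(i', j', \<one>\<^bsub>G\<^esub> <#\<^bsub>G\<^esub> L i' j') = F x"
      using F_surj by blast
    obtain i j h where ijh: "x = (i, j, h <#\<^bsub>G\<^esub> K i j)" "i \<in> I" "j \<in> J i" "h \<in> carrier G"
      using x(1) by (rule dom.coset_cases)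
    then show ?thesis using x(2) F by auto
  qed
  have \<alpha>_inj: "inj_on \<alpha> I"
  proof (rule inj_onI)
    fix i i' assume i: "i \<in> I" "i' \<in> I" and "\<alpha> i = \<alpha> i'"
    have "inj_on \<psi> B" using aut unfolding brace_automorphism_def iso_def bij_betw_def by blast
    moreover have "i \<subseteq> B" if "i \<in> I" for i
      by (subst dom.orbit_of_representative(2) [OF that])
        (rule image_subsetI, rule Th_closed [OF _ dom.orbit_of_representative(1) [OF that]])
    ultimately show "i = i'"
      using i \<open>\<alpha> i = \<alpha> i'\<close> unfolding \<alpha>_def by (metis inj_on_image_eq_iff)
  qed
  have \<alpha>_bij: "bij_betw \<alpha> I I'"
    unfolding bij_betw_def using \<alpha>_inj \<alpha>I hit cod.J_nonempty by blast
  have \<beta>_bij: "bij_betw (\<beta> i) (J i) (J' (\<alpha> i))" if i: "i \<in> I" for i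
    unfolding bij_betw_def
  proof
    show "inj_on (\<beta> i) (J i)"
    proof (rule inj_onI)
      fix j j' assume j: "j \<in> J i" "j' \<in> J i" and eq: "\<beta> i j = \<beta> i j'"
      \<comment> \<open>Two base points mapped into the same component are in the same \<open>G\<close>-orbit.\<close>
      obtain h where h: "h \<in> carrier G" "t i j' \<otimes>\<^bsub>G\<^esub> inv\<^bsub>G\<^esub> (t i j) = ?\<Psi> h"
        using \<Psi>_surj [OF semi.m_closed [OF t [OF i j(2)] semi.inv_closed [OF t [OF i j(1)]]]] by blast
      have "?\<Psi> h \<otimes>\<^bsub>G\<^esub> t i j = t i j'"
        using semi.mult_inv_cancel [OF t [OF i j(2)] t [OF i j(1)]] h(2) by simp
      then have "F (i, j, h <#\<^bsub>G\<^esub> K i j) = F (i, j', \<one>\<^bsub>G\<^esub> <#\<^bsub>G\<^esub> K i j')"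
        using F [OF i j(1) h(1)] base [OF i j(2)] eq by simp
      then show "j = j'"
        using F_eq_iff dom.coset_I [OF i j(1) h(1)] base_I [OF i j(2)] by blast
    qed
    show "\<beta> i ` J i = J' (\<alpha> i)"
    proof
      show "\<beta> i ` J i \<subseteq> J' (\<alpha> i)" using \<beta>J i by blast
      show "J' (\<alpha> i) \<subseteq> \<beta> i ` J i"
      proof
        fix j' assume "j' \<in> J' (\<alpha> i)"
        then obtain i0 j where "i0 \<in> I" "j \<in> J i0" "\<alpha> i = \<alpha> i0" "j' = \<beta> i0 j"
          using hit \<alpha>I i by blast
        moreover from this have "i0 = i" using \<alpha>_inj i by (auto simp: inj_on_def)
        ultimately show "j' \<in> \<beta> i ` J i" by blast
      qed
    qed
  qed
  \<comment> \<open>The left side is the image under \<open>\<Psi>\<close> of the stabilizer of a base point, the right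
    side is the stabilizer of the image of that point.\<close>
  have conj: "?\<Psi> ` K i j = t i j <#\<^bsub>G\<^esub> L (\<alpha> i) (\<beta> i j) #>\<^bsub>G\<^esub> inv\<^bsub>G\<^esub> (t i j)" (is "_ = ?C")
    if i: "i \<in> I" and j: "j \<in> J i" for i j
  proof -
    let ?o = "(i, j, \<one>\<^bsub>G\<^esub> <#\<^bsub>G\<^esub> K i j)"
    have KG: "K i j \<subseteq> carrier G" using subgroup.subset dom.K_sub i j by blast
    have LG: "L (\<alpha> i) (\<beta> i j) \<subseteq> carrier G" using subgroup.subset cod.K_sub \<alpha>I \<beta>J i j by blast
    have stab: "k \<in> K i j \<longleftrightarrow> ?\<Psi> k \<in> ?C" if k: "k \<in> carrier G" for k
    proof -
      have "k \<in> K i j \<longleftrightarrow> k \<in> \<one>\<^bsub>G\<^esub> <#\<^bsub>G\<^esub> K i j #>\<^bsub>G\<^esub> inv\<^bsub>G\<^esub> \<one>\<^bsub>G\<^esub>"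
        using semi.lcos_mult_one [OF KG] semi.coset_mult_one [OF KG] by simp
      also have "\<dots> \<longleftrightarrow> dom.cact k ?o = ?o"
        using dom.act_fixes_coset_iff [OF i j semi.one_closed k] by simp
      also have "\<dots> \<longleftrightarrow> F (dom.cact k ?o) = F ?o"
        using F_eq_iff dom.act_closed [OF k base_I [OF i j]] base_I [OF i j] by blast
      also have "\<dots> \<longleftrightarrow> ?\<Psi> k \<in> ?C"
        unfolding equi [OF k base_I [OF i j]] base [OF i j]
        by (rule cod.act_fixes_coset_iff [OF \<alpha>I [OF i] \<beta>J [OF i j] t [OF i j] \<Psi>_closed [OF k]])
      finally show ?thesis .
    qed
    have CG: "?C \<subseteq> carrier G"
      using LG t [OF i j] by (intro semi.r_coset_subset_G semi.l_coset_subset_G semi.inv_closed)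
    show ?thesis
    proof
      show "?\<Psi> ` K i j \<subseteq> ?C"
        by (rule image_subsetI) (rule stab [THEN iffD1, OF subsetD [OF KG]])
      show "?C \<subseteq> ?\<Psi> ` K i j"
      proof
        fix g assume g: "g \<in> ?C"
        obtain k where k: "k \<in> carrier G" "g = ?\<Psi> k" using \<Psi>_surj [OF subsetD [OF CG g]] ..
        then have "k \<in> K i j" using stab g by simp
        then show "g \<in> ?\<Psi> ` K i j" using k(2) by (rule rev_image_eqI)
      qed
    qed
  qed
  have "matching \<psi> \<alpha> \<beta> t"
    unfolding matching_def by (intro conjI ballI aut \<alpha>_bij \<beta>_bij t rep conj)
  then show ?thesis by (rule that)
qed

end

section \<open>Classification up to isomorphism\<close>

theorem theorem3p20:
  fixes S M :: "'b monoid"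
    and a :: "'b set \<Rightarrow> 'b"
    and I I' :: "'b set set"
    and J :: "'b set \<Rightarrow> 'j set" and J' :: "'b set \<Rightarrow> 'k set"
    and K :: "'b set \<Rightarrow> 'j \<Rightarrow> ('b \<times> 'b) set" and L :: "'b set \<Rightarrow> 'k \<Rightarrow> ('b \<times> 'b) set"
  defines "G \<equiv> brace_semidirect S M"
    and "\<Theta> \<equiv> brace_action S M"
  assumes brace: "skew_left_brace S M"
    and representatives: "\<And>i. i \<in> orbits G (carrier S) \<Theta> \<Longrightarrow> a i \<in> i"
    and I: "I \<subseteq> orbits G (carrier S) \<Theta>" "I \<noteq> {}" "generate S (\<Union>I) = carrier S"
    and J: "\<And>i. i \<in> I \<Longrightarrow> J i \<noteq> {}"
    and K: "\<And>i j. i \<in> I \<Longrightarrow> j \<in> J i \<Longrightarrow> subgroup (K i j) G"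
      "\<And>i j. i \<in> I \<Longrightarrow> j \<in> J i \<Longrightarrow> K i j \<subseteq> stabilizer G \<Theta> (a i)"
    and core_K: "{b \<in> carrier S.
        (\<one>\<^bsub>S\<^esub>, b) \<in> (\<Inter>i\<in>I. \<Inter>j\<in>J i. normal_core G (K i j)) \<and>
        (b, b) \<in> (\<Inter>i\<in>I. \<Inter>j\<in>J i. normal_core G (K i j))} = {\<one>\<^bsub>S\<^esub>}"
    and I': "I' \<subseteq> orbits G (carrier S) \<Theta>" "I' \<noteq> {}" "generate S (\<Union>I') = carrier S"
    and J': "\<And>i. i \<in> I' \<Longrightarrow> J' i \<noteq> {}"
    and L: "\<And>i j. i \<in> I' \<Longrightarrow> j \<in> J' i \<Longrightarrow> subgroup (L i j) G"
      "\<And>i j. i \<in> I' \<Longrightarrow> j \<in> J' i \<Longrightarrow> L i j \<subseteq> stabilizer G \<Theta> (a i)"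
    and core_L: "{b \<in> carrier S.
        (\<one>\<^bsub>S\<^esub>, b) \<in> (\<Inter>i\<in>I'. \<Inter>j\<in>J' i. normal_core G (L i j)) \<and>
        (b, b) \<in> (\<Inter>i\<in>I'. \<Inter>j\<in>J' i. normal_core G (L i j))} = {\<one>\<^bsub>S\<^esub>}"
  shows "yb_isomorphic
      (brace_sol_set S M I J K) (brace_sol_map S M a K)
      (brace_sol_set S M I' J' L) (brace_sol_map S M a L)
    \<longleftrightarrow>
    (\<exists>\<psi> \<alpha> \<beta> y z.
      brace_automorphism S M \<psi> \<and>
      bij_betw \<alpha> I I' \<and>
      (\<forall>i\<in>I. bij_betw (\<beta> i) (J i) (J' (\<alpha> i))) \<and>
      (\<forall>i\<in>I. \<forall>j\<in>J i. y i j \<in> carrier S \<and> z i j \<in> carrier S) \<and>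
      (\<forall>i\<in>I. \<forall>j\<in>J i.
        \<psi> (a i) = \<Theta> (y i j, z i j) (a (\<alpha> i)) \<and>
        map_prod \<psi> \<psi> ` K i j =
          (y i j, z i j) <#\<^bsub>G\<^esub> L (\<alpha> i) (\<beta> i j) #>\<^bsub>G\<^esub> inv\<^bsub>G\<^esub> (y i j, z i j)))"
    (is "?iso \<longleftrightarrow> (\<exists>\<psi> \<alpha> \<beta> y z. ?match \<psi> \<alpha> \<beta> y z)")
proof -
  interpret skew_left_brace S M by (rule brace)
  interpret coset_family_pair S M a I J K I' J' L
  proof (intro coset_family_pair.intro coset_family.intro coset_family_axioms.intro brace)
    show "I \<subseteq> orbits (brace_semidirect S M) (carrier S) (brace_action S M)"
      "I' \<subseteq> orbits (brace_semidirect S M) (carrier S) (brace_action S M)"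
      using I(1) I'(1) unfolding G_def \<Theta>_def .
    show "a i \<in> i" if "i \<in> I" for i using representatives I(1) that by blast
    show "a i \<in> i" if "i \<in> I'" for i using representatives I'(1) that by blast
    show "b = \<one>\<^bsub>S\<^esub>" if "b \<in> carrier S"
      "\<And>i j. i \<in> I \<Longrightarrow> j \<in> J i \<Longrightarrow> (\<one>\<^bsub>S\<^esub>, b) \<in> normal_core (brace_semidirect S M) (K i j)"
      "\<And>i j. i \<in> I \<Longrightarrow> j \<in> J i \<Longrightarrow> (b, b) \<in> normal_core (brace_semidirect S M) (K i j)" for b
      using core_K that unfolding G_def by blast
    show "b = \<one>\<^bsub>S\<^esub>" if "b \<in> carrier S"
      "\<And>i j. i \<in> I' \<Longrightarrow> j \<in> J' i \<Longrightarrow> (\<one>\<^bsub>S\<^esub>, b) \<in> normal_core (brace_semidirect S M) (L i j)"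
      "\<And>i j. i \<in> I' \<Longrightarrow> j \<in> J' i \<Longrightarrow> (b, b) \<in> normal_core (brace_semidirect S M) (L i j)" for b
      using core_L that unfolding G_def by blast
  qed (use I(3) I'(3) J J' K L in \<open>simp_all add: G_def \<Theta>_def\<close>)
  have match_iff: "matching \<psi> \<alpha> \<beta> (\<lambda>i j. (y i j, z i j)) \<longleftrightarrow> ?match \<psi> \<alpha> \<beta> y z" for \<psi> \<alpha> \<beta> y z
    unfolding matching_def G_def \<Theta>_def by (simp del: mult_G) blast
  show ?thesis
  proof
    assume ?iso
    then obtain \<psi> \<alpha> \<beta> t where "matching \<psi> \<alpha> \<beta> t" by (rule isomorphic_imp_matching)
    then have "?match \<psi> \<alpha> \<beta> (\<lambda>i j. fst (t i j)) (\<lambda>i j. snd (t i j))"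
      by (subst match_iff [symmetric]) simp
    then show "\<exists>\<psi> \<alpha> \<beta> y z. ?match \<psi> \<alpha> \<beta> y z" by (intro exI)
  next
    assume "\<exists>\<psi> \<alpha> \<beta> y z. ?match \<psi> \<alpha> \<beta> y z"
    then obtain \<psi> \<alpha> \<beta> y z where "?match \<psi> \<alpha> \<beta> y z" by (elim exE)
    then show ?iso by (rule matching_imp_isomorphic [OF match_iff [THEN iffD2]])
  qed
qed

end
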